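(* Let $\alpha$ be an algebraic number satisfying $0<\alpha\leq 1$, and let $(\mathbb{X}_\alpha(n))_{n\geq 0}$ be random variables on a common probability space, each taking values in the unit circle, such that $$\mathbb{E}\left[\mathbb{X}_\alpha(n_1)^{e_1}\cdots\mathbb{X}_\alpha(n_k)^{e_k}\right]=\begin{cases}1 & \text{if } (n_1+\alpha)^{e_1}\cdots(n_k+\alpha)^{e_k}=1,\\ 0 & \text{otherwise}\end{cases}$$ for all integers $n_1,\ldots,n_k\geq 0$ and $e_1,\ldots,e_k\in\mathbb{Z}$. Let $\sigma>1/2$ be fixed. Then, as $T\to\infty$, the probability measure $$P_{\sigma,\alpha,T}(A)=\frac{1}{T}\,\mathrm{meas}\{t\in[0,T] : \zeta(\sigma+it,\alpha)\in A\},\qquad A\in\mathcal{B}(\mathbb{C}),$$ converges weakly to the law of the random variable $\zeta(\sigma,\mathbb{X}_\alpha)=\sum_{n=0}^\infty \mathbb{X}_\alpha(n)(n+\alpha)^{-\sigma}$.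
   Context: $\zeta(s,\alpha)=\sum_{n=0}^\infty (n+\alpha)^{-s}$ (for $\mathrm{Re}\,s>1$) is the Hurwitz zeta-function, extended by analytic continuation to $\mathbb{C}\setminus\{1\}$. $\mathrm{meas}$ is one-dimensional Lebesgue measure and $\mathcal{B}(\mathbb{C})$ the Borel sets of $\mathbb{C}$. Under the stated moment condition the $\mathbb{X}_\alpha(n)$ are orthonormal ($\mathbb{E}[\mathbb{X}_\alpha(m)\overline{\mathbb{X}_\alpha(n)}]=1$ if $m=n$ and $0$ otherwise), and the series $\sum_{n\ge0}\mathbb{X}_\alpha(n)(n+\alpha)^{-\sigma}$ converges almost surely for $\sigma>1/2$; $\zeta(\sigma,\mathbb{X}_\alpha)$ denotes its sum. *)

theory Defs
  imports "HOL-Complex_Analysis.Complex_Analysis" "HOL-Probability.Probability"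
begin

section \<open>The Hurwitz zeta-function\<close>

text \<open>
  The value at the pole \<open>s = 1\<close> is arbitrary; elsewhere the choice is unique (for \<open>0 < a\<close>).
  Existence is the theorem \<open>hurwitz_zeta_continuation_exists\<close> below.
\<close>

definition hurwitz_zeta :: "real \<Rightarrow> complex \<Rightarrow> complex" where
  "hurwitz_zeta a = (SOME f. f holomorphic_on (- {1}) \<and>
     (\<forall>s. Re s > 1 \<longrightarrow> (\<lambda>n. of_real (real n + a) powr (- s)) sums f s))"

lemma holomorphic_on_integral_param:
  fixes F :: "complex \<Rightarrow> real \<Rightarrow> complex"
  assumes U: "open U"
    and cont: "continuous_on (U \<times> {0..1}) (\<lambda>(s, v). F s v)"
    and hol: "\<And>v. v \<in> {0..1} \<Longrightarrow> (\<lambda>s. F s v) holomorphic_on U"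
  shows "(\<lambda>s. integral {0..1} (F s)) holomorphic_on U"
proof -
  define f where "f = (\<lambda>s (z::complex). F s (Re z))"
  have I: "integral {0..1} (F s) = contour_integral (linepath 0 1) (f s)" for s
    by (subst contour_integral_linepath_Reals_eq) (auto simp: f_def)
  have img: "path_image (linepath 0 1) \<subseteq> {z::complex. Re z \<in> {0..1}}"
    by (auto simp: linepath_def path_image_def)
  have fcont: "continuous_on (U \<times> {z. Re z \<in> {0..1}}) (\<lambda>(s, z). f s z)"
    unfolding f_def case_prod_unfold
    by (intro continuous_on_compose2[OF cont[unfolded case_prod_unfold], of _ "\<lambda>x. (fst x, Re (snd x))", simplified]
          continuous_intros) auto
  have "(\<lambda>s. integral {0..1} (F s)) analytic_on U"
  proof (rule Morera_triangle[OF _ U], goal_cases)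
    case 1
    show ?case
      using integral_continuous_on_param[of U 0 1 F] cont by simp
  next
    case (2 a b c)
    show ?case
    proof
      assume sub: "convex hull {a, b, c} \<subseteq> U"
      have swap: "contour_integral (linepath p q) (\<lambda>s. integral {0..1} (F s)) =
          contour_integral (linepath 0 1) (\<lambda>z. contour_integral (linepath p q) (\<lambda>s. f s z))"
        and cint: "(\<lambda>z. contour_integral (linepath p q) (\<lambda>s. f s z)) contour_integrable_on linepath 0 1"
        if pq: "p \<in> {a, b, c}" "q \<in> {a, b, c}" for p q
      proof -
        have "closed_segment p q \<subseteq> convex hull {a, b, c}"
          using pq by (intro closed_segment_subset convex_convex_hull) (auto intro: hull_inc)
        hence pU: "path_image (linepath p q) \<subseteq> U" using sub by simp
        show "contour_integral (linepath p q) (\<lambda>s. integral {0..1} (F s)) =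
          contour_integral (linepath 0 1) (\<lambda>z. contour_integral (linepath p q) (\<lambda>s. f s z))"
          unfolding I
          by (rule contour_integral_swap)
             (use pU img in \<open>auto intro!: continuous_on_subset[OF fcont]\<close>)
        have lin: "continuous_on ({0..1} \<times> {0..1}) (\<lambda>x :: real \<times> real. linepath p q (snd x))"
          unfolding linepath_def by (intro continuous_intros)
        have "continuous_on ({0..1} \<times> cbox 0 1) (\<lambda>(z, x). f (linepath p q x) (complex_of_real z))"
          unfolding case_prod_unfold
          by (intro continuous_on_compose2[OF fcont[unfolded case_prod_unfold],
                of _ "\<lambda>x. (linepath p q (snd x), of_real (fst x))", simplified]
              continuous_intros) (use pU in \<open>auto simp: path_image_def lin\<close>)
        hence "continuous_on {0..1} (\<lambda>z. integral (cbox 0 1) (\<lambda>x. f (linepath p q x) (complex_of_real z)))"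
          by (rule integral_continuous_on_param)
        from continuous_on_mult_right[OF this, of "q - p"]
        have "continuous_on {0..1} (\<lambda>z. contour_integral (linepath p q) (\<lambda>s. f s (of_real z)))"
          by (simp add: contour_integral_integral)
        hence "continuous_on (closed_segment 0 1) (\<lambda>z. contour_integral (linepath p q) (\<lambda>s. f s z))"
          by (rule continuous_on_compose2[of "{0..1}" _ _ Re, unfolded o_def, THEN continuous_on_eq])
             (auto simp: f_def closed_segment_def intro!: continuous_intros)
        thus "(\<lambda>z. contour_integral (linepath p q) (\<lambda>s. f s z)) contour_integrable_on linepath 0 1"
          by (rule contour_integrable_continuous_linepath)
      qed
      have zero: "contour_integral (linepath a b) (\<lambda>s. f s z) + contour_integral (linepath b c) (\<lambda>s. f s z) +
            contour_integral (linepath c a) (\<lambda>s. f s z) = 0" if "z \<in> path_image (linepath 0 1)" for z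
      proof -
        have "(\<lambda>s. f s z) holomorphic_on convex hull {a, b, c}"
          using hol[of "Re z"] that img holomorphic_on_subset[OF _ sub] by (auto simp: f_def)
        from Cauchy_theorem_triangle[OF this]
        have "((\<lambda>s. f s z) has_contour_integral 0) (linepath a b +++ linepath b c +++ linepath c a)" .
        thus ?thesis
          by (rule has_chain_integral_chain_integral3)
      qed
      show "contour_integral (linepath a b) (\<lambda>s. integral {0..1} (F s)) +
            contour_integral (linepath b c) (\<lambda>s. integral {0..1} (F s)) +
            contour_integral (linepath c a) (\<lambda>s. integral {0..1} (F s)) = 0"
        by (simp add: swap cint contour_integrable_add flip: contour_integral_add)
           (subst contour_integral_cong[OF refl zero], auto simp: algebra_simps)
    qed
  qed
  thus ?thesis by (rule analytic_imp_holomorphic)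
qed

definition hz_series :: "complex \<Rightarrow> real \<Rightarrow> complex" where
  "hz_series s a = (\<Sum>n. of_real (real n + a) powr (- s))"

text \<open>
  Built on \<open>\<zeta>(s,a) = a\<^sup>1\<^sup>-\<^sup>s / (s - 1) + s \<integral>\<^sub>0\<^sup>1 (1 - v) \<zeta>(s + 1, a + v) dv\<close>:
  \<open>hz_step N\<close> continues \<open>(s - 1) \<zeta>(s,a)\<close> to \<open>Re s > 1 - N\<close>.
\<close>

fun hz_step :: "nat \<Rightarrow> complex \<Rightarrow> real \<Rightarrow> complex" where
  "hz_step 0 s a = (s - 1) * hz_series s a"
| "hz_step (Suc N) s a = of_real a powr (1 - s) +
     (s - 1) * integral {0..1} (\<lambda>v. of_real (1 - v) * hz_step N (s + 1) (a + v))"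

lemma hz_uniform_limit:
  assumes c: "c > 1"
  shows "uniform_limit {(s, a). Re s > c \<and> a > 0}
     (\<lambda>N (s, a). \<Sum>n<N. of_real (real n + a) powr (- s)) (\<lambda>(s, a). hz_series s a) sequentially"
proof -
  have "uniform_limit {(s, a). Re s > c \<and> a > 0}
     (\<lambda>N x. \<Sum>n<N. of_real (real n + snd x) powr (- fst x))
     (\<lambda>x. \<Sum>n. of_real (real n + snd x) powr (- fst x) :: complex) sequentially"
  proof (rule Weierstrass_m_test_ev)
    show "summable (\<lambda>n. real n powr (- c))"
      using c by (simp add: summable_real_powr_iff)
    show "\<forall>\<^sub>F n in sequentially. \<forall>x\<in>{(s, a). Re s > c \<and> a > 0}.
        norm (of_real (real n + snd x) powr (- fst x) :: complex) \<le> real n powr (- c)"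
      using eventually_ge_at_top[of 1]
    proof eventually_elim
      case (elim n)
      show ?case
      proof safe
        fix s :: complex and a :: real assume *: "Re s > c" "a > 0"
        have "norm (of_real (real n + a) powr (- s) :: complex) = (real n + a) powr (- Re s)"
          using * by (subst norm_powr_real_powr) auto
        also have "\<dots> \<le> (real n + a) powr (- c)"
          using * elim by (intro powr_mono) auto
        also have "\<dots> \<le> real n powr (- c)"
          using * elim c by (intro powr_mono2') auto
        finally show "norm (of_real (real n + snd (s, a)) powr (- fst (s, a)) :: complex) \<le> real n powr (- c)"
          by simp
      qed
    qed
  qed
  thus ?thesis by (simp add: case_prod_unfold hz_series_def)
qed

lemma hz_series_sums:
  assumes "Re s > 1" "a > 0"
  shows "(\<lambda>n. of_real (real n + a) powr (- s)) sums hz_series s a"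
proof -
  obtain c where c: "1 < c" "c < Re s" using dense[of 1 "Re s"] assms by auto
  have "uniform_limit {(s, a)} (\<lambda>N (s, a). \<Sum>n<N. of_real (real n + a) powr (- s))
          (\<lambda>(s, a). hz_series s a) sequentially"
    by (rule uniform_limit_on_subset[OF hz_uniform_limit[OF c(1)]]) (use c assms in auto)
  thus ?thesis by (simp add: sums_def)
qed

lemma open_halfplane_prod: "open {(s, a::real). Re s > c \<and> a > 0}"
  unfolding case_prod_unfold by (intro open_Collect_conj open_Collect_less continuous_intros)

lemma hz_series_continuous: "continuous_on {(s, a). Re s > 1 \<and> a > 0} (\<lambda>(s, a). hz_series s a)"
proof -
  have "isCont (\<lambda>(s, a). hz_series s a) (s, a)" if sa: "Re s > 1" "a > 0" for s a
  proof -
    obtain c where c: "1 < c" "c < Re s" using dense[of 1 "Re s"] sa by auto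
    have "continuous_on {(s, a). Re s > c \<and> a > 0} (\<lambda>(s, a). hz_series s a)"
    proof (rule uniform_limit_theorem[OF always_eventually[OF allI] hz_uniform_limit[OF c(1)]])
      show "continuous_on {(s, a). Re s > c \<and> a > 0}
              (\<lambda>(s, a). \<Sum>n<N. of_real (real n + a) powr (- s) :: complex)" for N
        unfolding case_prod_unfold by (intro continuous_intros) (auto simp: complex_eq_iff)
    qed simp
    moreover have "(s, a) \<in> {(s, a). Re s > c \<and> a > 0}" using c sa by simp
    ultimately show ?thesis
      using continuous_on_eq_continuous_at[OF open_halfplane_prod] by blast
  qed
  thus ?thesis by (auto intro!: continuous_at_imp_continuous_on)
qed

lemma hz_series_holomorphic:
  assumes "a > 0"
  shows "(\<lambda>s. hz_series s a) holomorphic_on {s. Re s > 1}"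
proof (rule holomorphic_uniform_sequence)
  show "open {s. Re s > 1}" by (rule open_halfspace_Re_gt)
  show "(\<lambda>s. \<Sum>n<N. of_real (real n + a) powr (- s)) holomorphic_on {s. Re s > 1}" for N
    by (intro holomorphic_intros)
next
  fix s assume "s \<in> {s. Re s > 1}"
  then obtain c where c: "1 < c" "c < Re s" using dense[of 1 "Re s"] by auto
  have op: "open {s. Re s > c}" by (rule open_halfspace_Re_gt)
  then obtain d where d: "d > 0" "cball s d \<subseteq> {s. Re s > c}"
    using c open_contains_cball[of "{s. Re s > c}"] by auto
  have "uniform_limit (cball s d) (\<lambda>N s. \<Sum>n<N. of_real (real n + a) powr (- s))
          (\<lambda>s. hz_series s a) sequentially"
    using uniform_limit_compose'[OF hz_uniform_limit[OF c(1)], of "\<lambda>s. (s, a)" "cball s d"]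
      d assms by auto
  thus "\<exists>d>0. cball s d \<subseteq> {s. 1 < Re s} \<and>
          uniform_limit (cball s d) (\<lambda>N s. \<Sum>n<N. of_real (real n + a) powr (- s))
          (\<lambda>s. hz_series s a) sequentially"
    using d c by (intro exI[of _ d]) auto
qed

lemma hz_term_integral:
  fixes s :: complex
  assumes "y > 0" "s \<noteq> 1"
  shows "((\<lambda>v. of_real (1 - v) * (s * of_real (y + v) powr (- (s + 1)))) has_integral
           (of_real y powr (- s) - (of_real y powr (1 - s) - of_real (y + 1) powr (1 - s)) / (s - 1))) {0..1}"
proof -
  define \<Phi> :: "complex \<Rightarrow> complex" where "\<Phi> = (\<lambda>z. (z - 1) * (of_real y + z) powr (- s) + (of_real y + z) powr (1 - s) / (s - 1))"
  have D: "((\<lambda>v. \<Phi> (of_real v)) has_vector_derivative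
         of_real (1 - v) * (s * of_real (y + v) powr (- (s + 1)))) (at v within {0..1})"
    if "v \<in> {0..1}" for v
  proof -
    have nz: "of_real y + of_real v \<notin> (\<real>\<^sub>\<le>\<^sub>0 :: complex set)"
      using that assms by (auto simp: complex_nonpos_Reals_iff)
    have P: "((\<lambda>z. (of_real y + z) powr w) has_field_derivative w * (of_real y + of_real v) powr (w - 1)) 
         (at (of_real v))" for w :: complex
    proof -
      have "((\<lambda>z. of_real y + z) has_field_derivative 1) (at (of_real v :: complex))"
        by (auto intro!: derivative_eq_intros)
      from DERIV_chain2[where g = "\<lambda>z. of_real y + z" and f = "\<lambda>z. z powr w" and x = "of_real v" and s = UNIV,
            OF has_field_derivative_powr[OF nz, of w] this] show ?thesis by simp
    qed
    have "(\<Phi> has_field_derivative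
        (1 * (of_real y + of_real v) powr (- s) +
         (- s * (of_real y + of_real v) powr (- s - 1)) * (of_real v - 1) +
         (1 - s) * (of_real y + of_real v) powr ((1 - s) - 1) / (s - 1))) (at (of_real v))"
      unfolding \<Phi>_def
      by (intro DERIV_add DERIV_mult DERIV_cdivide P) (auto intro!: derivative_eq_intros)
    also have "(1 * (of_real y + of_real v) powr (- s) +
         (- s * (of_real y + of_real v) powr (- s - 1)) * (of_real v - 1) +
         (1 - s) * (of_real y + of_real v) powr ((1 - s) - 1) / (s - 1)) =
         of_real (1 - v) * (s * of_real (y + v) powr (- (s + 1)))"
      using assms by (simp add: divide_simps) (simp add: algebra_simps)
    finally show ?thesis
      by (rule has_vector_derivative_real_field[THEN has_vector_derivative_at_within])
  qed
  have "((\<lambda>v. of_real (1 - v) * (s * of_real (y + v) powr (- (s + 1)))) has_integral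
           (\<Phi> (of_real 1) - \<Phi> (of_real 0))) {0..1}"
    by (rule fundamental_theorem_of_calculus) (use D in auto)
  thus ?thesis by (simp add: \<Phi>_def algebra_simps diff_divide_distrib)
qed

lemma hz_step_1:
  assumes s: "Re s > 1" and a: "a > 0"
  shows "hz_step 1 s a = hz_step 0 s a"
proof -
  have s1: "s \<noteq> 1" using s by auto
  define g where "g = (\<lambda>N v. \<Sum>n<N. of_real (1 - v) * (s * of_real (real n + a + v) powr (- (s + 1))))"
  have "uniform_limit {0..1} (\<lambda>N v. \<Sum>n<N. of_real (real n + (a + v)) powr (- (s + 1)))
          (\<lambda>v. hz_series (s + 1) (a + v)) sequentially"
    using uniform_limit_compose'[OF hz_uniform_limit[OF s], of "\<lambda>v. (s + 1, a + v)" "{0..1}"] a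
    by auto
  hence u0: "uniform_limit {0..1} (\<lambda>N v. (of_real (1 - v) * s) * (\<Sum>n<N. of_real (real n + (a + v)) powr (- (s + 1))))
          (\<lambda>v. (of_real (1 - v) * s) * hz_series (s + 1) (a + v)) sequentially"
  proof (intro uniform_lim_mult[OF uniform_limit_const])
    show "bounded ((\<lambda>v. complex_of_real (1 - v) * s) ` {0..1})"
      by (intro compact_imp_bounded compact_continuous_image continuous_intros) auto
    have "continuous_on {0..1} (\<lambda>v. hz_series (s + 1) (a + v))"
      using s a
      by (intro continuous_on_compose2[OF hz_series_continuous[unfolded case_prod_unfold],
            of _ "\<lambda>v. (s + 1, a + v)", simplified] continuous_intros) auto
    thus "bounded ((\<lambda>v. hz_series (s + 1) (a + v)) ` {0..1})"
      by (intro compact_imp_bounded compact_continuous_image) auto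
  qed auto
  have u: "uniform_limit {0..1} g (\<lambda>v. of_real (1 - v) * hz_step 0 (s + 1) (a + v)) sequentially"
    using u0 by (simp add: g_def sum_distrib_left mult_ac add_ac)
  have gc: "continuous_on {0..1} (g N)" for N
    unfolding g_def using a
    by (intro continuous_intros) (auto simp: complex_eq_iff)
  obtain I J where IJ: "\<And>n. (g n has_integral I n) {0..1}"
    "((\<lambda>v. of_real (1 - v) * hz_step 0 (s + 1) (a + v)) has_integral J) {0..1}" "I \<longlonglongrightarrow> J"
    using uniform_limit_integral[OF u gc] by auto
  define t where "t = (\<lambda>n. of_real (real n + a) powr (- s) -
     (of_real (real n + a) powr (1 - s) - of_real (real (Suc n) + a) powr (1 - s)) / (s - 1))"
  have "(g N has_integral (\<Sum>n<N. t n)) {0..1}" for N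
    unfolding g_def t_def
  proof (intro has_integral_sum finite_lessThan)
    fix n
    show "((\<lambda>v. of_real (1 - v) * (s * of_real (real n + a + v) powr (- (s + 1)))) has_integral
       (of_real (real n + a) powr (- s) -
     (of_real (real n + a) powr (1 - s) - of_real (real (Suc n) + a) powr (1 - s)) / (s - 1))) {0..1}"
      using hz_term_integral[of "real n + a" s] a s1 by (simp add: add_ac)
  qed
  hence "I = (\<lambda>N. \<Sum>n<N. t n)" using IJ(1) has_integral_unique by blast
  hence "t sums J" using IJ(3) by (simp add: sums_def)
  moreover have "t sums (hz_series s a - (of_real (real 0 + a) powr (1 - s) - 0) / (s - 1))"
    unfolding t_def
  proof (rule sums_diff[OF hz_series_sums[OF s a] sums_divide[OF telescope_sums']])
    have "((\<lambda>n. (real n + a) powr (1 - Re s)) \<longlongrightarrow> 0) sequentially"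
    proof (rule tendsto_neg_powr)
      show "filterlim (\<lambda>n. real n + a) at_top sequentially"
        using filterlim_tendsto_add_at_top[OF tendsto_const[of a] filterlim_real_sequentially]
        by (simp add: add.commute)
    qed (use s in auto)
    thus "(\<lambda>n. of_real (real n + a) powr (1 - s)) \<longlonglongrightarrow> (0 :: complex)"
      by (rule tendsto_norm_zero_cancel[OF tendsto_cong[THEN iffD1, rotated]])
         (use a in \<open>auto simp: norm_powr_real_powr intro!: always_eventually\<close>)
  qed
  ultimately have "J = hz_series s a - of_real a powr (1 - s) / (s - 1)"
    using sums_unique2 by fastforce
  thus ?thesis
    using integral_unique[OF IJ(2)] s1 by (simp add: field_simps)
qed

lemma hz_step_Suc_eq:
  assumes "Re s > 1 - real N" "a > 0"
  shows "hz_step (Suc N) s a = hz_step N s a"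
  using assms
proof (induction N arbitrary: s a)
  case 0
  thus ?case using hz_step_1[of s a] by simp
next
  case (Suc N)
  have "hz_step (Suc N) (s + 1) (a + v) = hz_step N (s + 1) (a + v)" if "v \<in> {0..1}" for v
    using Suc.prems that by (intro Suc.IH) auto
  thus ?case
    by (simp only: hz_step.simps(2)[of "Suc N"] hz_step.simps(2)[of N] cong: integral_cong)
qed

lemma hz_step_eq:
  assumes "Re s > 1 - real N" "a > 0" "N \<le> M"
  shows "hz_step M s a = hz_step N s a"
  using assms(3)
proof (induction M rule: dec_induct)
  case (step M)
  thus ?case using hz_step_Suc_eq[of M s a] assms by auto
qed auto

lemma hz_step_regular:
  "continuous_on {(s, a). Re s > 1 - real N \<and> a > 0} (\<lambda>(s, a). hz_step N s a) \<and>
   (\<forall>a>0. (\<lambda>s. hz_step N s a) holomorphic_on {s. Re s > 1 - real N})"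
proof (induction N)
  case 0
  show ?case
    using hz_series_continuous
    by (auto simp: case_prod_unfold intro!: continuous_intros holomorphic_intros hz_series_holomorphic)
next
  case (Suc N)
  let ?A = "{(s, a). Re s > 1 - real (Suc N) \<and> a > (0::real)}"
  have C: "continuous_on {(s, a). Re s > 1 - real N \<and> a > 0} (\<lambda>x. hz_step N (fst x) (snd x))"
    using Suc.IH by (simp add: case_prod_unfold)
  have "continuous_on (?A \<times> cbox 0 1) (\<lambda>(x, v). of_real (1 - v) * hz_step N (fst x + 1) (snd x + v))"
    unfolding case_prod_unfold
    by (intro continuous_intros continuous_on_compose2[OF C, of _ "\<lambda>x. (fst (fst x) + 1, snd (fst x) + snd x)", simplified])
       auto
  from integral_continuous_on_param[OF this]
  have 1: "continuous_on ?A (\<lambda>x. integral {0..1} (\<lambda>v. of_real (1 - v) * hz_step N (fst x + 1) (snd x + v)))"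
    by simp
  have "continuous_on ?A (\<lambda>x. hz_step (Suc N) (fst x) (snd x))"
    unfolding hz_step.simps
    by (intro continuous_intros 1) (auto simp: complex_eq_iff)
  moreover have "(\<lambda>s. hz_step (Suc N) s a) holomorphic_on {s. Re s > 1 - real (Suc N)}" if a: "a > 0" for a
    unfolding hz_step.simps
  proof (intro holomorphic_intros holomorphic_on_integral_param open_halfspace_Re_gt)
    show "continuous_on ({s. Re s > 1 - real (Suc N)} \<times> {0..1})
       (\<lambda>(s, v). of_real (1 - v) * hz_step N (s + 1) (a + v))"
      unfolding case_prod_unfold
      by (intro continuous_intros continuous_on_compose2[OF C, of _ "\<lambda>x. (fst x + 1, a + snd x)", simplified])
         (use a in auto)
    fix v :: real assume "v \<in> {0..1}"
    hence "(\<lambda>s. hz_step N s (a + v)) holomorphic_on {s. Re s > 1 - real N}"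
      using Suc.IH a by auto
    hence "((\<lambda>s. hz_step N s (a + v)) \<circ> (\<lambda>s. s + 1)) holomorphic_on {s. Re s > 1 - real (Suc N)}"
      by (intro holomorphic_on_compose_gen[where t = "{s. Re s > 1 - real N}"] holomorphic_intros) auto
    thus "(\<lambda>s. hz_step N (s + 1) (a + v)) holomorphic_on {s. Re s > 1 - real (Suc N)}"
      by (simp add: o_def)
  qed
  ultimately show ?case by (auto simp: case_prod_unfold)
qed

theorem hurwitz_zeta_continuation_exists:
  assumes a: "a > 0"
  shows "\<exists>f. f holomorphic_on (- {1}) \<and>
     (\<forall>s. Re s > 1 \<longrightarrow> (\<lambda>n. of_real (real n + a) powr (- s)) sums f s)"
proof -
  define f where "f = (\<lambda>s. hz_step (nat \<lceil>2 - Re s\<rceil>) s a / (s - 1))"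
  have f_eq: "f s = hz_step N s a / (s - 1)" if "Re s > 1 - real N" for N s
  proof -
    define K where "K = nat \<lceil>2 - Re s\<rceil>"
    have K: "Re s > 1 - real K" unfolding K_def by linarith
    have "hz_step K s a = hz_step N s a"
      using hz_step_eq[OF K a, of "max K N"] hz_step_eq[OF that a, of "max K N"] by simp
    thus ?thesis by (simp add: f_def K_def)
  qed
  have "f holomorphic_on (- {1})"
  proof -
    have "f holomorphic_on (\<Union>N. {s. Re s > 1 - real N} \<inter> (- {1}))"
    proof (rule holomorphic_on_UN_open)
      fix N :: nat
      have "(\<lambda>s. hz_step N s a / (s - 1)) holomorphic_on {s. Re s > 1 - real N} \<inter> (- {1})"
        using hz_step_regular[of N] a
        by (auto intro!: holomorphic_intros intro: holomorphic_on_subset)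
      thus "f holomorphic_on {s. Re s > 1 - real N} \<inter> (- {1})"
        by (rule holomorphic_transform) (use f_eq in auto)
      show "open ({s. Re s > 1 - real N} \<inter> (- {1}))"
        by (intro open_Int open_halfspace_Re_gt open_Compl) auto
    qed
    also have "(\<Union>N. {s. Re s > 1 - real N} \<inter> (- {1})) = - {1}"
    proof -
      have "\<exists>N. Re s > 1 - real N" for s
        using reals_Archimedean2[of "1 - Re s"] by (auto simp: algebra_simps)
      thus ?thesis by auto
    qed
    finally show ?thesis .
  qed
  moreover have "(\<lambda>n. of_real (real n + a) powr (- s)) sums f s" if "Re s > 1" for s
  proof -
    have "f s = hz_series s a" using f_eq[of 0 s] that by auto
    thus ?thesis using hz_series_sums[OF that a] by simp
  qed
  ultimately show ?thesis by blast
qed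

lemma
  assumes "a > 0"
  shows hurwitz_zeta_holomorphic: "hurwitz_zeta a holomorphic_on (- {1})"
    and hurwitz_zeta_sums: "Re s > 1 \<Longrightarrow> (\<lambda>n. of_real (real n + a) powr (- s)) sums hurwitz_zeta a s"
  using someI_ex[OF hurwitz_zeta_continuation_exists[OF assms]]
  unfolding hurwitz_zeta_def by blast+

lemma hurwitz_zeta_unique:
  assumes "a > 0" and f: "f holomorphic_on (- {1})"
    and sums: "\<And>s. Re s > 1 \<Longrightarrow> (\<lambda>n. of_real (real n + a) powr (- s)) sums f s"
    and "s \<noteq> 1"
  shows "hurwitz_zeta a s = f s"
proof (rule analytic_continuation_open[where s = "{s. Re s > 1}" and s' = "- {1}"
      and f = "hurwitz_zeta a" and g = f and z = s])
  have "Re 2 > 1" by simp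
  thus "{s. Re s > 1} \<noteq> {}" by blast
  show "connected (- {1 :: complex})"
    using connected_punctured_universe[of "1 :: complex"] by simp
  show "hurwitz_zeta a z = f z" if "z \<in> {s. Re s > 1}" for z
    using that hurwitz_zeta_sums[OF assms(1)] sums sums_unique2 by blast
qed (use assms hurwitz_zeta_holomorphic in \<open>auto simp: open_halfspace_Re_gt\<close>)

lemma measurable_hurwitz_zeta:
  assumes "a > 0"
  shows "hurwitz_zeta a \<in> borel_measurable borel"
  by (rule borel_measurable_continuous_countable_exceptions[where X = "{1}"])
     (use holomorphic_on_imp_continuous_on[OF hurwitz_zeta_holomorphic[OF assms]] in auto)


section \<open>The measures\<close>

definition zeta_value_measure :: "real \<Rightarrow> real \<Rightarrow> real \<Rightarrow> complex measure" where
  "zeta_value_measure \<sigma> \<alpha> T =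
     distr (uniform_measure lborel {0..T}) borel (\<lambda>t. hurwitz_zeta \<alpha> (Complex \<sigma> t))"

lemma measurable_hurwitz_zeta_vertical:
  assumes "\<alpha> > 0"
  shows "(\<lambda>t. hurwitz_zeta \<alpha> (Complex \<sigma> t)) \<in> borel_measurable borel"
proof -
  have "(\<lambda>t. Complex \<sigma> t) \<in> borel_measurable borel"
    unfolding Complex_eq by (intro borel_measurable_continuous_onI continuous_intros)
  from measurable_compose[OF this measurable_hurwitz_zeta[OF assms]] show ?thesis .
qed

lemma measure_zeta_value_measure:
  assumes "\<alpha> > 0" "T > 0" and A: "A \<in> sets borel"
  shows "measure (zeta_value_measure \<sigma> \<alpha> T) A =
           measure lebesgue {t \<in> {0..T}. hurwitz_zeta \<alpha> (Complex \<sigma> t) \<in> A} / T"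
proof -
  note [measurable] = measurable_hurwitz_zeta_vertical[OF assms(1), of \<sigma>] A
  let ?B = "(\<lambda>t. hurwitz_zeta \<alpha> (Complex \<sigma> t)) -` A"
  have B: "?B \<in> sets borel"
    using measurable_sets[OF measurable_hurwitz_zeta_vertical[OF assms(1), of \<sigma>] A] by simp
  have "emeasure lborel {0..T} \<noteq> \<infinity>" "emeasure lborel {0..T} \<noteq> 0"
    using assms by auto
  hence "measure (zeta_value_measure \<sigma> \<alpha> T) A = measure lborel ({0..T} \<inter> ?B) / measure lborel {0..T}"
    unfolding zeta_value_measure_def using B
    by (subst measure_distr) (auto simp: measure_uniform_measure)
  also have "{0..T} \<inter> ?B = {t \<in> {0..T}. hurwitz_zeta \<alpha> (Complex \<sigma> t) \<in> A}" by auto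
  also have "measure lborel \<dots> = measure lebesgue \<dots>"
    by (rule measure_completion[symmetric]) (use B in \<open>auto simp: Int_def[symmetric] vimage_def\<close>)
  finally show ?thesis using assms by simp
qed

lemma prob_space_zeta_value_measure:
  assumes "\<alpha> > 0" "T > 0"
  shows "prob_space (zeta_value_measure \<sigma> \<alpha> T)"
  unfolding zeta_value_measure_def using assms measurable_hurwitz_zeta_vertical[OF assms(1), of \<sigma>]
  by (intro prob_space.prob_space_distr prob_space_uniform_measure) auto

text \<open>
  Only almost sure convergence of the series is available; \<open>suminf\<close> is a fixed
  unspecified constant on the (null, measurable) set where it diverges.
\<close>

definition random_hurwitz_zeta :: "real \<Rightarrow> real \<Rightarrow> (nat \<Rightarrow> 'a \<Rightarrow> complex) \<Rightarrow> 'a \<Rightarrow> complex" where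
  "random_hurwitz_zeta \<sigma> \<alpha> X \<omega> = (\<Sum>n. X n \<omega> * of_real ((real n + \<alpha>) powr (- \<sigma>)))"

lemma measurable_random_hurwitz_zeta:
  assumes "\<And>n. X n \<in> borel_measurable M"
  shows "random_hurwitz_zeta \<sigma> \<alpha> X \<in> borel_measurable M"
proof -
  note [measurable] = assms
  have "(\<lambda>\<omega>. \<Sum>n. X n \<omega> * of_real ((real n + \<alpha>) powr (- \<sigma>))) \<in> borel_measurable M"
    by measurable
  thus ?thesis by (simp add: random_hurwitz_zeta_def[abs_def])
qed

text \<open>
  The weak convergence of the libraries is defined through distribution functions, hence only for
  sequences of measures on the reals.
\<close>

definition converges_weakly ::
  "('i \<Rightarrow> 'b::topological_space measure) \<Rightarrow> 'b measure \<Rightarrow> 'i filter \<Rightarrow> bool" where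
  "converges_weakly P Q F \<longleftrightarrow>
     (\<forall>f :: 'b \<Rightarrow> real. continuous_on UNIV f \<and> bounded (range f) \<longrightarrow>
        ((\<lambda>i. \<integral>x. f x \<partial>P i) \<longlongrightarrow> (\<integral>x. f x \<partial>Q)) F)"

end

theory Submission
  imports Defs
begin

text \<open>
  A Hurwitz polynomial is a fixed function of finitely many unimodular numbers \<open>(n + \<alpha>)\<^sup>-\<^sup>i\<^sup>t\<close>, whose
  mixed moments over \<open>[0,T]\<close> converge to those of the \<open>X\<^sub>n\<close>; by Stone-Weierstrass the means of
  every continuous function of the polynomial converge.

  To pass to \<open>\<zeta>\<close> for \<open>\<sigma> > 1/2\<close>, first-order Euler-Maclaurin at \<open>N = \<lfloor>T\<rfloor>\<close> writes \<open>\<zeta>(s,\<alpha>)\<close> as the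
  partial sum of length \<open>N\<close>, plus \<open>(N+\<alpha>)\<^sup>1\<^sup>-\<^sup>s/(s-1)\<close>, plus
  \<open>s \<integral>\<^sub>0\<^sup>1 (1-v) \<zeta>(s+1,N+\<alpha>+v) dv\<close>. In the remainder \<open>\<zeta>(s+1,\<cdot>)\<close> is an absolutely convergent
  Dirichlet series, so one elementary mean value estimate controls both it and the terms
  \<open>M \<le> n < N\<close>: the remainder has mean square at most of order
  \<open>T\<^sup>1\<^sup>-\<^sup>2\<^sup>\<sigma> T\<^sup>\<sigma>\<^sup>-\<^sup>1\<^sup>/\<^sup>2\<close>, which tends to \<open>0\<close> because \<open>\<sigma> > 1/2\<close>.

  On the random side the series converges almost surely by the dyadic argument of Rademacher and
  Menshov, applied to orthogonal terms.
\<close>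

section \<open>Mean squares of Dirichlet polynomials\<close>

text \<open>Separates the diagonal, which produces the main term of the mean square, from the
  oscillating pairs \<open>m < n\<close>. The induction adds the cross terms of one new summand at a
  time.\<close>

lemma norm_sum_cis_square:
  fixes a \<theta> :: "nat \<Rightarrow> real"
  shows "(norm (\<Sum>n<K. of_real (a n) * cis (\<theta> n)))\<^sup>2 =
    (\<Sum>n<K. (a n)\<^sup>2) + 2 * (\<Sum>n<K. \<Sum>m<n. a m * a n * cos (\<theta> n - \<theta> m))"
proof (induction K)
  case (Suc K)
  define z where "z = (\<Sum>n<K. of_real (a n) * cis (\<theta> n))"
  have "(norm (z + of_real (a K) * cis (\<theta> K)))\<^sup>2 =
      (norm z)\<^sup>2 + (norm (of_real (a K) * cis (\<theta> K)))\<^sup>2 + 2 * Re (z * cnj (of_real (a K) * cis (\<theta> K)))"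
    unfolding cmod_power2 by (simp add: power2_eq_square algebra_simps)
  also have "(norm (of_real (a K) * cis (\<theta> K)))\<^sup>2 = (a K)\<^sup>2"
    by (simp add: norm_mult)
  also have "Re (z * cnj (of_real (a K) * cis (\<theta> K))) = (\<Sum>m<K. a m * a K * cos (\<theta> K - \<theta> m))"
    by (simp add: z_def sum_distrib_left cos_diff algebra_simps sum.distrib)
  finally show ?case
    using Suc.IH by (simp add: z_def algebra_simps)
qed simp

lemma has_integral_cos_mult:
  fixes d :: real
  assumes "d \<noteq> 0" "T \<ge> 0"
  shows "((\<lambda>t. cos (t * d)) has_integral sin (T * d) / d) {0..T}"
proof -
  have "((\<lambda>t. cos (t * d)) has_integral sin (T * d) / d - sin (0 * d) / d) {0..T}"
    using assms
    by (intro fundamental_theorem_of_calculus)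
       (auto intro!: derivative_eq_intros simp flip: has_real_derivative_iff_has_vector_derivative)
  thus ?thesis by simp
qed

text \<open>After integration each cosine contributes at most \<open>1 / |d m n|\<close>, and
  \<open>ln x <= x - 1\<close> at \<open>x = (m + b) / (n + b)\<close> bounds this by
  \<open>(n + b) / (n - m)\<close>. Nonnegative coefficients make the comparison possible term by
  term.\<close>

lemma mean_square_dirichlet_polynomial:
  fixes a :: "nat \<Rightarrow> real" and b :: real
  assumes a: "\<And>n. a n \<ge> 0" and b: "b > 0" and T: "T \<ge> 0"
  shows "integral {0..T} (\<lambda>t. (norm (\<Sum>n<K. of_real (a n) * cis (- t * ln (real n + b))))\<^sup>2)
    \<le> T * (\<Sum>n<K. (a n)\<^sup>2) + 2 * (\<Sum>n<K. \<Sum>m<n. a m * a n * ((real n + b) / (real n - real m)))"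
proof -
  define d where "d = (\<lambda>m n. ln (real m + b) - ln (real n + b))"
  have d: "d m n \<noteq> 0" "1 / \<bar>d m n\<bar> \<le> (real n + b) / (real n - real m)" if "m < n" for m n
  proof -
    have "ln ((real m + b) / (real n + b)) \<le> (real m + b) / (real n + b) - 1"
      using b that by (intro ln_le_minus_one) auto
    also have "\<dots> = - ((real n - real m) / (real n + b))"
      using b by (simp add: field_simps)
    finally have *: "d m n \<le> - ((real n - real m) / (real n + b))"
      using b by (simp add: d_def ln_div)
    have pos: "(real n - real m) / (real n + b) > 0" using that b by simp
    show "d m n \<noteq> 0" using * pos by linarith
    have "(real n - real m) / (real n + b) \<le> \<bar>d m n\<bar>" using * pos by linarith
    from le_imp_inverse_le[OF this pos] show "1 / \<bar>d m n\<bar> \<le> (real n + b) / (real n - real m)"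
      by (simp add: inverse_eq_divide)
  qed
  have "((\<lambda>t. (\<Sum>n<K. (a n)\<^sup>2) + 2 * (\<Sum>n<K. \<Sum>m<n. a m * a n * cos (t * d m n))) has_integral
      ((T - 0) *\<^sub>R (\<Sum>n<K. (a n)\<^sup>2) + 2 * (\<Sum>n<K. \<Sum>m<n. a m * a n * (sin (T * d m n) / d m n)))) {0..T}"
    using d T by (intro has_integral_add has_integral_mult_right has_integral_sum
      has_integral_const_real[of _ 0 T, simplified content_real[OF T]] has_integral_cos_mult) auto
  moreover have "(\<lambda>t. (norm (\<Sum>n<K. of_real (a n) * cis (- t * ln (real n + b))))\<^sup>2) =
      (\<lambda>t. (\<Sum>n<K. (a n)\<^sup>2) + 2 * (\<Sum>n<K. \<Sum>m<n. a m * a n * cos (t * d m n)))"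
    unfolding norm_sum_cis_square by (simp add: d_def algebra_simps)
  ultimately have "integral {0..T} (\<lambda>t. (norm (\<Sum>n<K. of_real (a n) * cis (- t * ln (real n + b))))\<^sup>2) =
      T * (\<Sum>n<K. (a n)\<^sup>2) + 2 * (\<Sum>n<K. \<Sum>m<n. a m * a n * (sin (T * d m n) / d m n))"
    by (simp add: integral_unique)
  also have "a m * a n * (sin (T * d m n) / d m n) \<le> a m * a n * ((real n + b) / (real n - real m))"
    if "m < n" for m n
  proof (intro mult_left_mono mult_nonneg_nonneg a)
    have "sin (T * d m n) / d m n \<le> \<bar>sin (T * d m n)\<bar> / \<bar>d m n\<bar>"
      by (metis abs_divide abs_ge_self)
    also have "\<dots> \<le> 1 / \<bar>d m n\<bar>" by (intro divide_right_mono) auto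
    finally show "sin (T * d m n) / d m n \<le> (real n + b) / (real n - real m)" using d[OF that] by linarith
  qed
  hence "(\<Sum>n<K. \<Sum>m<n. a m * a n * (sin (T * d m n) / d m n)) \<le>
      (\<Sum>n<K. \<Sum>m<n. a m * a n * ((real n + b) / (real n - real m)))"
    by (intro sum_mono) auto
  finally show ?thesis by simp
qed

text \<open>
  Since \<open>n + b\<close> exceeds both \<open>m + b\<close> and \<open>n - m\<close>, a factor \<open>(n - m)\<^sup>-\<^sup>\<delta>\<close> can be split off from
  \<open>(n + b)\<^sup>-\<^sup>q\<close>; it makes the sum over \<open>n - m\<close> converge.
\<close>

lemma schur_sum_bound:
  fixes b p q \<delta> :: real
  assumes b: "b > 0" and \<delta>: "0 < \<delta>" "\<delta> \<le> q"
  shows "(\<Sum>n<K. \<Sum>m<n. (real m + b) powr (- p) * (real n + b) powr (- q) / (real n - real m))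
    \<le> (\<Sum>k. real k powr (- 1 - \<delta>)) * (\<Sum>n<K. (real n + b) powr (- (p + q - \<delta>)))"
proof -
  \<comment> \<open>The term \<open>k = 0\<close> of this series is \<open>0\<close>, because
    \<open>0 powr x = 0\<close>.\<close>
  have summ: "summable (\<lambda>k. real k powr (- 1 - \<delta>))"
    using \<delta> by (simp add: summable_real_powr_iff)
  have "(\<Sum>n<K. \<Sum>m<n. (real m + b) powr (- p) * (real n + b) powr (- q) / (real n - real m))
      \<le> (\<Sum>n<K. \<Sum>m<n. (real m + b) powr (- (p + q - \<delta>)) * real (n - m) powr (- 1 - \<delta>))"
  proof (intro sum_mono)
    fix n m :: nat assume "m \<in> {..<n}"
    hence mn: "m < n" by simp
    have nm: "x powr (- \<delta>) / x = x powr (- 1 - \<delta>)" if "x > 0" for x :: real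
      proof -
      have "- 1 - \<delta> = - \<delta> - 1" by simp
      thus ?thesis using that by (simp only: powr_diff) simp
    qed
    have "(real n + b) powr (- q) = (real n + b) powr (- (q - \<delta>)) * (real n + b) powr (- \<delta>)"
      by (simp flip: powr_add)
    also have "\<dots> \<le> (real m + b) powr (- (q - \<delta>)) * real (n - m) powr (- \<delta>)"
      using mn b \<delta> by (intro mult_mono powr_mono2') (auto simp: of_nat_diff)
    finally have "(real m + b) powr (- p) * (real n + b) powr (- q) / (real n - real m)
        \<le> (real m + b) powr (- p) * ((real m + b) powr (- (q - \<delta>)) * real (n - m) powr (- \<delta>)) / (real n - real m)"
      using mn by (intro divide_right_mono mult_left_mono) auto
    also have "\<dots> = ((real m + b) powr (- p) * (real m + b) powr (- (q - \<delta>))) *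
        (real (n - m) powr (- \<delta>) / real (n - m))"
      using mn by (simp add: of_nat_diff)
    also have "\<dots> = (real m + b) powr (- (p + q - \<delta>)) * real (n - m) powr (- 1 - \<delta>)"
      using mn by (subst nm) (simp_all add: algebra_simps flip: powr_add)
    finally show "(real m + b) powr (- p) * (real n + b) powr (- q) / (real n - real m)
        \<le> (real m + b) powr (- (p + q - \<delta>)) * real (n - m) powr (- 1 - \<delta>)" .
  qed
  \<comment> \<open>With \<open>m\<close> fixed outside, the inner sum runs over distinct values of
    \<open>n - m\<close> and is a partial sum of the series over \<open>k\<close>.\<close>
  also have "\<dots> = (\<Sum>m<K. \<Sum>n\<in>{m<..<K}. (real m + b) powr (- (p + q - \<delta>)) * real (n - m) powr (- 1 - \<delta>))"
    unfolding sum.Sigma[OF finite_lessThan ballI[OF finite_lessThan]]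
      sum.Sigma[OF finite_lessThan ballI[OF finite_greaterThanLessThan]]
    by (rule sum.reindex_bij_witness[of _ "\<lambda>(m, n). (n, m)" "\<lambda>(n, m). (m, n)"]) auto
  also have "\<dots> \<le> (\<Sum>m<K. (real m + b) powr (- (p + q - \<delta>)) * (\<Sum>k. real k powr (- 1 - \<delta>)))"
    unfolding sum_distrib_left[symmetric]
  proof (intro sum_mono mult_left_mono)
    fix m
    have "(\<Sum>n\<in>{m<..<K}. real (n - m) powr (- 1 - \<delta>)) = (\<Sum>k\<in>(\<lambda>n. n - m) ` {m<..<K}. real k powr (- 1 - \<delta>))"
      by (subst sum.reindex) (auto simp: inj_on_def)
    also have "\<dots> \<le> (\<Sum>k. real k powr (- 1 - \<delta>))"
      by (intro sum_le_suminf summ) auto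
    finally show "(\<Sum>n\<in>{m<..<K}. real (n - m) powr (- 1 - \<delta>)) \<le> (\<Sum>k. real k powr (- 1 - \<delta>))" .
  qed auto
  finally show ?thesis by (simp add: sum_distrib_left sum_distrib_right mult.commute)
qed

section \<open>Partial sums of the Hurwitz series at a shifted argument\<close>

lemma of_real_powr_Complex:
  assumes "x > 0"
  shows "of_real x powr (- Complex \<sigma> t) = of_real (x powr (- \<sigma>)) * cis (- t * ln x)"
proof -
  have "of_real x powr (- Complex \<sigma> t) = exp (of_real (- \<sigma> * ln x) + \<i> * of_real (- t * ln x))"
    using assms by (simp add: powr_def Ln_of_real Complex_eq algebra_simps)
  also have "\<dots> = of_real (x powr (- \<sigma>)) * cis (- t * ln x)"
    unfolding exp_add using assms by (simp add: cis_conv_exp powr_def flip: exp_of_real)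
  finally show ?thesis .
qed

text \<open>The shift \<open>b\<close> is a free parameter so that the terms
  \<open>M <= n < N\<close> of the series at \<open>a\<close> form again such a sum, with
  \<open>b = M + a\<close>.\<close>

definition hz_sum :: "nat \<Rightarrow> real \<Rightarrow> real \<Rightarrow> real \<Rightarrow> complex" where
  "hz_sum K b \<sigma> t = (\<Sum>n<K. of_real (real n + b) powr (- Complex \<sigma> t))"

lemma hz_sum_conv_cis:
  assumes "b > 0"
  shows "hz_sum K b \<sigma> t = (\<Sum>n<K. of_real ((real n + b) powr (- \<sigma>)) * cis (- t * ln (real n + b)))"
  unfolding hz_sum_def using assms by (intro sum.cong refl of_real_powr_Complex) auto

lemma continuous_on_hz_sum [continuous_intros]:
  assumes "b > 0"
  shows "continuous_on A (hz_sum K b \<sigma>)"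
proof -
  have "hz_sum K b \<sigma> = (\<lambda>t. \<Sum>n<K. of_real ((real n + b) powr (- \<sigma>)) * cis (- t * ln (real n + b)))"
    by (rule ext, rule hz_sum_conv_cis[OF assms])
  thus ?thesis by (auto intro!: continuous_intros)
qed

text \<open>The constant of \<open>schur_sum_bound\<close> for \<open>\<delta> = \<sigma> - 1/2\<close>, chosen so that \<open>2\<sigma> - \<delta> = \<sigma> + 1/2 > 1\<close>.\<close>

definition hz_const :: "real \<Rightarrow> real" where
  "hz_const \<sigma> = (\<Sum>k. real k powr (- 1 - (\<sigma> - 1 / 2)))"

lemma hz_const_nonneg: "\<sigma> > 1 / 2 \<Longrightarrow> hz_const \<sigma> \<ge> 0"
  unfolding hz_const_def by (intro suminf_nonneg) (auto simp: summable_real_powr_iff)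

text \<open>The bound \<open>schur_sum_bound\<close> is used with \<open>p = q = \<sigma>\<close>,
  after the factor \<open>n + b\<close> of the cross terms has been replaced by
  \<open>K + b\<close>. This loses nothing essential when \<open>K + b\<close> is of order
  \<open>T\<close>. By \<open>b >= 1\<close> the diagonal terms, of exponent
  \<open>2 * \<sigma>\<close>, are dominated by those of exponent \<open>\<sigma> + 1 / 2\<close>,
  so one sum serves for both parts.\<close>

lemma mean_square_hz_sum:
  assumes \<sigma>: "\<sigma> > 1 / 2" and b: "b \<ge> 1" and T: "T \<ge> 0"
  shows "integral {0..T} (\<lambda>t. (norm (hz_sum K b \<sigma> t))\<^sup>2) \<le>
    (T + 2 * hz_const \<sigma> * (real K + b)) * (\<Sum>n<K. (real n + b) powr (- (\<sigma> + 1 / 2)))"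
    (is "_ \<le> _ * ?S")
proof -
  let ?a = "\<lambda>n. (real n + b) powr (- \<sigma>)"
  have b0: "b > 0" using b by simp
  have "integral {0..T} (\<lambda>t. (norm (hz_sum K b \<sigma> t))\<^sup>2) \<le>
      T * (\<Sum>n<K. (?a n)\<^sup>2) + 2 * (\<Sum>n<K. \<Sum>m<n. ?a m * ?a n * ((real n + b) / (real n - real m)))"
    unfolding hz_sum_conv_cis[OF b0] by (rule mean_square_dirichlet_polynomial) (use b T in auto)
  also have "(\<Sum>n<K. (?a n)\<^sup>2) \<le> ?S"
    using b \<sigma> by (intro sum_mono) (auto simp: power2_eq_square powr_mono simp flip: powr_add)
  also have "(\<Sum>n<K. \<Sum>m<n. ?a m * ?a n * ((real n + b) / (real n - real m))) \<le>
      (\<Sum>n<K. \<Sum>m<n. (real K + b) * (?a m * ?a n / (real n - real m)))"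
  proof (intro sum_mono)
    fix n m assume "n \<in> {..<K}" "m \<in> {..<n}"
    hence "(real n + b) * (?a m * ?a n / (real n - real m)) \<le> (real K + b) * (?a m * ?a n / (real n - real m))"
      by (intro mult_right_mono) auto
    thus "?a m * ?a n * ((real n + b) / (real n - real m)) \<le> (real K + b) * (?a m * ?a n / (real n - real m))"
      by (simp add: mult_ac)
  qed
  also have "\<dots> = (real K + b) * (\<Sum>n<K. \<Sum>m<n. ?a m * ?a n / (real n - real m))"
    by (simp add: sum_distrib_left)
  also have "(\<Sum>n<K. \<Sum>m<n. ?a m * ?a n / (real n - real m)) \<le> hz_const \<sigma> * ?S"
    using schur_sum_bound[of b "\<sigma> - 1 / 2" \<sigma> \<sigma> K] b0 \<sigma> by (simp add: hz_const_def)
  also have "T * ?S + 2 * ((real K + b) * (hz_const \<sigma> * ?S)) = (T + 2 * hz_const \<sigma> * (real K + b)) * ?S"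
    by (simp add: algebra_simps)
  finally show ?thesis using T b by (simp add: mult_left_mono)
qed

text \<open>At \<open>\<sigma> + 1\<close> the additional decay absorbs the factor
  \<open>n + b\<close> of the cross terms, so no factor \<open>K + b\<close> appears and the bound
  survives the passage to the infinite series. With \<open>p = \<sigma> + 1\<close> and
  \<open>q = \<sigma>\<close> the remaining exponent is \<open>\<sigma> + 3 / 2\<close>; its surplus
  over \<open>\<sigma> + 1 / 2\<close> yields the factor \<open>1 / b\<close>.\<close>

lemma mean_square_hz_sum_shifted:
  assumes \<sigma>: "\<sigma> > 1 / 2" and b: "b \<ge> 1" and T: "T \<ge> 0"
  shows "integral {0..T} (\<lambda>t. (norm (hz_sum K b (\<sigma> + 1) t))\<^sup>2) \<le>
    (T / b\<^sup>2 + 2 * hz_const \<sigma> / b) * (\<Sum>n<K. (real n + b) powr (- (\<sigma> + 1 / 2)))"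
    (is "_ \<le> _ * ?S")
proof -
  let ?a = "\<lambda>n. (real n + b) powr (- (\<sigma> + 1))"
  have b0: "b > 0" using b by simp
  have "integral {0..T} (\<lambda>t. (norm (hz_sum K b (\<sigma> + 1) t))\<^sup>2) \<le>
      T * (\<Sum>n<K. (?a n)\<^sup>2) + 2 * (\<Sum>n<K. \<Sum>m<n. ?a m * ?a n * ((real n + b) / (real n - real m)))"
    unfolding hz_sum_conv_cis[OF b0] by (rule mean_square_dirichlet_polynomial) (use b T in auto)
  also have "(\<Sum>n<K. (?a n)\<^sup>2) \<le> (\<Sum>n<K. (real n + b) powr (- (\<sigma> + 1 / 2)) / b\<^sup>2)"
  proof (intro sum_mono)
    fix n
    have "(?a n)\<^sup>2 = (real n + b) powr (- 2 * \<sigma>) * (real n + b) powr (- 2)"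
      using b by (simp add: power2_eq_square flip: powr_add)
    also have "\<dots> \<le> (real n + b) powr (- (\<sigma> + 1 / 2)) * b powr (- 2)"
      using b \<sigma> by (intro mult_mono powr_mono powr_mono2') auto
    finally show "(?a n)\<^sup>2 \<le> (real n + b) powr (- (\<sigma> + 1 / 2)) / b\<^sup>2"
      using b by (simp add: powr_minus_divide)
  qed
  also have "(\<Sum>n<K. \<Sum>m<n. ?a m * ?a n * ((real n + b) / (real n - real m))) =
      (\<Sum>n<K. \<Sum>m<n. (real m + b) powr (- (\<sigma> + 1)) * (real n + b) powr (- \<sigma>) / (real n - real m))"
  proof (intro sum.cong refl)
    fix n m
    have "?a n * (real n + b) = (real n + b) powr (- (\<sigma> + 1)) * (real n + b) powr 1"
      using b by (subst powr_one) auto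
    also have "\<dots> = (real n + b) powr (- \<sigma>)" by (subst powr_add [symmetric]) simp
    finally show "?a m * ?a n * ((real n + b) / (real n - real m)) =
       (real m + b) powr (- (\<sigma> + 1)) * (real n + b) powr (- \<sigma>) / (real n - real m)"
      by (simp add: mult.assoc)
  qed
  also have "\<dots> \<le> hz_const \<sigma> * (\<Sum>n<K. (real n + b) powr (- (\<sigma> + 1 + \<sigma> - (\<sigma> - 1 / 2))))"
    using schur_sum_bound[of b "\<sigma> - 1 / 2" \<sigma> "\<sigma> + 1" K] b0 \<sigma> by (simp add: hz_const_def)
  also have "(\<Sum>n<K. (real n + b) powr (- (\<sigma> + 1 + \<sigma> - (\<sigma> - 1 / 2)))) \<le> (\<Sum>n<K. (real n + b) powr (- (\<sigma> + 1 / 2)) / b)"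
  proof (intro sum_mono)
    fix n
    have "(real n + b) powr (- (\<sigma> + 1 + \<sigma> - (\<sigma> - 1 / 2))) = (real n + b) powr (- (\<sigma> + 1 / 2)) * (real n + b) powr (- 1)"
      by (subst powr_add [symmetric], rule arg_cong[of _ _ "(powr) _"]) (simp add: field_simps)
    also have "\<dots> \<le> (real n + b) powr (- (\<sigma> + 1 / 2)) * b powr (- 1)"
      using b by (intro mult_left_mono powr_mono2') auto
    finally show "(real n + b) powr (- (\<sigma> + 1 + \<sigma> - (\<sigma> - 1 / 2))) \<le> (real n + b) powr (- (\<sigma> + 1 / 2)) / b"
      using b by (simp only: powr_minus_divide[of b 1]) simp
  qed
  also have "T * (\<Sum>n<K. (real n + b) powr (- (\<sigma> + 1 / 2)) / b\<^sup>2) +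
      2 * (hz_const \<sigma> * (\<Sum>n<K. (real n + b) powr (- (\<sigma> + 1 / 2)) / b)) = (T / b\<^sup>2 + 2 * hz_const \<sigma> / b) * ?S"
    by (simp add: algebra_simps flip: sum_divide_distrib)
  finally show ?thesis using T hz_const_nonneg[OF \<sigma>] by (simp add: mult_left_mono)
qed

section \<open>Approximating the Hurwitz zeta-function in mean square\<close>

text \<open>At \<open>b = M + a\<close> this is the tail from \<open>n = M\<close> on of one fixed
  convergent series. It is the small factor in the estimates below.\<close>

definition hz_tail :: "real \<Rightarrow> real \<Rightarrow> real" where
  "hz_tail \<sigma> b = (\<Sum>n. (real n + b) powr (- (\<sigma> + 1 / 2)))"

lemma summable_shifted_powr:
  fixes b r :: real
  assumes "b > 0" "r > 1"
  shows "summable (\<lambda>n. (real n + b) powr (- r))"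
proof (rule summable_comparison_test_ev)
  show "summable (\<lambda>n. real n powr (- r))" using assms by (simp add: summable_real_powr_iff)
  show "\<forall>\<^sub>F n in sequentially. norm ((real n + b) powr (- r)) \<le> real n powr (- r)"
    using eventually_gt_at_top[of 0] by eventually_elim (use assms in \<open>auto intro: powr_mono2'\<close>)
qed

lemma sum_le_hz_tail:
  assumes "\<sigma> > 1 / 2" "b > 0"
  shows "(\<Sum>n<K. (real n + b) powr (- (\<sigma> + 1 / 2))) \<le> hz_tail \<sigma> b"
  unfolding hz_tail_def using assms by (intro sum_le_suminf summable_shifted_powr) auto

lemma hz_tail_nonneg: "\<sigma> > 1 / 2 \<Longrightarrow> b > 0 \<Longrightarrow> hz_tail \<sigma> b \<ge> 0"
  using sum_le_hz_tail[of \<sigma> b 0] by simp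

lemma hz_tail_mono: "\<sigma> > 1 / 2 \<Longrightarrow> 0 < b \<Longrightarrow> b \<le> c \<Longrightarrow> hz_tail \<sigma> c \<le> hz_tail \<sigma> b"
  unfolding hz_tail_def by (intro suminf_le summable_shifted_powr powr_mono2') auto

lemma hz_tail_tendsto_0:
  assumes "\<sigma> > 1 / 2" "b > 0"
  shows "(\<lambda>N. hz_tail \<sigma> (real N + b)) \<longlonglongrightarrow> 0"
proof -
  have "(\<lambda>N. \<Sum>n. (real (n + N) + b) powr (- (\<sigma> + 1 / 2))) \<longlonglongrightarrow> 0"
    using suminf_exist_split2[OF summable_shifted_powr[of b "\<sigma> + 1 / 2"]] assms by simp
  thus ?thesis by (simp add: hz_tail_def add_ac)
qed

lemma hz_series_sums_shift:
  assumes "Re s > 1" "a > 0"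
  shows "hz_series s a = (\<Sum>n<N. of_real (real n + a) powr (- s)) + hz_series s (real N + a)"
proof -
  have "(\<lambda>n. of_real (real (n + N) + a) powr (- s)) sums (hz_series s a - (\<Sum>n<N. of_real (real n + a) powr (- s)))"
    using sums_split_initial_segment[OF hz_series_sums[OF assms]] by simp
  moreover have "(\<lambda>n. of_real (real (n + N) + a) powr (- s)) sums hz_series s (real N + a)"
    using hz_series_sums[of s "real N + a"] assms by (simp add: add_ac)
  ultimately show ?thesis using sums_unique2 by (force simp: algebra_simps)
qed

text \<open>For \<open>Re s > 1\<close> the first \<open>N\<close> terms are split off and
  \<open>hz_step_1\<close> is applied to the rest, a Hurwitz series at \<open>N + a\<close>. Since
  \<open>hz_step 1\<close> is holomorphic for \<open>Re s > 0\<close>, the identity extends to that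
  half-plane without the pole.\<close>

lemma hurwitz_zeta_Euler_Maclaurin:
  assumes a: "a > 0" and s: "Re s > 0" "s \<noteq> 1"
  shows "hurwitz_zeta a s = (\<Sum>n<N. of_real (real n + a) powr (- s)) +
    of_real (real N + a) powr (1 - s) / (s - 1) +
    s * integral {0..1} (\<lambda>v. of_real (1 - v) * hz_series (s + 1) (real N + a + v))"
proof -
  define g where "g = (\<lambda>s. (\<Sum>n<N. of_real (real n + a) powr (- s)) + hz_step 1 s (real N + a) / (s - 1))"
  have a': "real N + a > 0" using a by simp
  have "hurwitz_zeta a s = g s"
  proof (rule analytic_continuation_open[where s = "{s. Re s > 1}" and s' = "{s. Re s > 0} - {1}"
      and f = "hurwitz_zeta a" and g = g and z = s])
    have "Re 2 > 1" by simp
    thus "{s. Re s > 1} \<noteq> {}" by blast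
    show "connected ({s. Re s > 0} - {1})"
      by (intro connected_open_delete open_halfspace_Re_gt convex_connected convex_halfspace_Re_gt) auto
    show "hurwitz_zeta a holomorphic_on {s. Re s > 0} - {1}"
      by (rule holomorphic_on_subset[OF hurwitz_zeta_holomorphic[OF a]]) auto
    have "(\<lambda>s. hz_step 1 s (real N + a)) holomorphic_on {s. Re s > 0}"
      using conjunct2[OF hz_step_regular[of 1], rule_format, OF a'] by (simp only: of_nat_1 diff_self)
    hence "(\<lambda>s. hz_step 1 s (real N + a)) holomorphic_on {s. Re s > 0} - {1}"
      by (rule holomorphic_on_subset) auto
    thus "g holomorphic_on {s. Re s > 0} - {1}"
      unfolding g_def using a by (intro holomorphic_intros) auto
    fix s :: complex assume "s \<in> {s. Re s > 1}"
    hence s: "Re s > 1" "s \<noteq> 1" by auto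
    have "hurwitz_zeta a s = hz_series s a"
      using hurwitz_zeta_sums[OF a s(1)] hz_series_sums[OF s(1) a] sums_unique2 by blast
    also have "\<dots> = g s"
      using s hz_step_1[OF s(1) a'] by (simp add: g_def hz_series_sums_shift[OF s(1) a, of N])
    finally show "hurwitz_zeta a s = g s" .
  qed (use s in \<open>auto simp: open_halfspace_Re_gt intro!: open_delete\<close>)
  \<comment> \<open>The factor \<open>s\<close> arises because \<open>hz_step 0\<close> at
    \<open>s + 1\<close> carries \<open>(s + 1) - 1\<close>; the outer factor \<open>s - 1\<close>
    cancels.\<close>
  moreover have "hz_step 1 s (real N + a) / (s - 1) = of_real (real N + a) powr (1 - s) / (s - 1) +
      s * integral {0..1} (\<lambda>v. of_real (1 - v) * hz_series (s + 1) (real N + a + v))"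
    using s(2) by (simp add: field_simps flip: integral_mult_right)
  ultimately show ?thesis by (simp add: g_def add.assoc)
qed

section \<open>Mean square of the Euler-Maclaurin remainder\<close>

lemma continuous_on_hz_series_vertical:
  assumes "\<sigma> > 1" "b > 0"
  shows "continuous_on A (\<lambda>t. hz_series (Complex \<sigma> t) b)"
  unfolding Complex_eq
  by (intro continuous_on_compose2[OF hz_series_continuous[unfolded case_prod_unfold],
        of _ "\<lambda>t. (of_real \<sigma> + \<i> * of_real t, b)", simplified] continuous_intros) (use assms in auto)

text \<open>The partial sums converge uniformly on \<open>{0..T}\<close>, and their mean squares are
  bounded independently of the length.\<close>

lemma mean_square_hz_series:
  assumes \<sigma>: "\<sigma> > 1 / 2" and b: "b \<ge> 1" and T: "T \<ge> 0"
  shows "integral {0..T} (\<lambda>t. (norm (hz_series (Complex (\<sigma> + 1) t) b))\<^sup>2) \<le>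
    (T / b\<^sup>2 + 2 * hz_const \<sigma> / b) * hz_tail \<sigma> b"
proof -
  have b0: "b > 0" using b by simp
  \<comment> \<open>Any abscissa strictly between \<open>1\<close> and \<open>\<sigma> + 1\<close>
    serves for the uniform convergence.\<close>
  have "1 < 1 + \<sigma> / 2" using \<sigma> by simp
  from uniform_limit_compose'[OF hz_uniform_limit[OF this], of "\<lambda>t. (Complex (\<sigma> + 1) t, b)" "{0..T}"]
  have u: "uniform_limit {0..T} (\<lambda>K t. hz_sum K b (\<sigma> + 1) t) (\<lambda>t. hz_series (Complex (\<sigma> + 1) t) b) sequentially"
    using \<sigma> b0 by (auto simp: hz_sum_def)
  have c: "continuous_on {0..T} (\<lambda>t. hz_series (Complex (\<sigma> + 1) t) b)"
    by (rule continuous_on_hz_series_vertical) (use \<sigma> b0 in auto)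
  have bnd: "bounded ((\<lambda>t. norm (hz_series (Complex (\<sigma> + 1) t) b)) ` {0..T})"
    by (intro compact_imp_bounded compact_continuous_image continuous_intros c) auto
  have u2: "uniform_limit {0..T} (\<lambda>K t. (norm (hz_sum K b (\<sigma> + 1) t))\<^sup>2)
     (\<lambda>t. (norm (hz_series (Complex (\<sigma> + 1) t) b))\<^sup>2) sequentially"
    unfolding power2_eq_square by (intro uniform_lim_mult uniform_limit_intros u bnd)
  have c2: "continuous_on {0..T} (\<lambda>t. (norm (hz_sum K b (\<sigma> + 1) t))\<^sup>2)" for K
    by (intro continuous_intros b0)
  obtain I J where IJ: "\<And>n. ((\<lambda>t. (norm (hz_sum n b (\<sigma> + 1) t))\<^sup>2) has_integral I n) {0..T}"
    "((\<lambda>t. (norm (hz_series (Complex (\<sigma> + 1) t) b))\<^sup>2) has_integral J) {0..T}" "I \<longlonglongrightarrow> J"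
    using uniform_limit_integral[OF u2 c2] by auto
  have "I K \<le> (T / b\<^sup>2 + 2 * hz_const \<sigma> / b) * hz_tail \<sigma> b" for K
  proof -
    have "I K \<le> (T / b\<^sup>2 + 2 * hz_const \<sigma> / b) * (\<Sum>n<K. (real n + b) powr (- (\<sigma> + 1 / 2)))"
      using mean_square_hz_sum_shifted[OF \<sigma> b T, of K] integral_unique[OF IJ(1)] by simp
    also have "\<dots> \<le> (T / b\<^sup>2 + 2 * hz_const \<sigma> / b) * hz_tail \<sigma> b"
      using sum_le_hz_tail[OF \<sigma> b0] T b0 hz_const_nonneg[OF \<sigma>] by (intro mult_left_mono) auto
    finally show ?thesis .
  qed
  hence "J \<le> (T / b\<^sup>2 + 2 * hz_const \<sigma> / b) * hz_tail \<sigma> b"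
    using IJ(3) by (intro LIMSEQ_le_const2[OF IJ(3)]) auto
  thus ?thesis using integral_unique[OF IJ(2)] by simp
qed

text \<open>Cauchy-Schwarz on an interval of length one, obtained from the nonnegativity of the
  variance of \<open>norm (f v)\<close> about its mean \<open>c\<close>.\<close>

lemma norm_integral_unit_square_le:
  fixes f :: "real \<Rightarrow> complex"
  assumes f: "continuous_on {0..1} f"
  shows "(norm (integral {0..1} f))\<^sup>2 \<le> integral {0..1} (\<lambda>v. (norm (f v))\<^sup>2)"
proof -
  define c where "c = integral {0..1} (\<lambda>v. norm (f v))"
  have i: "(\<lambda>v. norm (f v)) integrable_on {0..1}" "(\<lambda>v. (norm (f v))\<^sup>2) integrable_on {0..1}"
    by (intro integrable_continuous_interval continuous_intros f)+
  have "norm (integral {0..1} f) \<le> c"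
    unfolding c_def using f by (intro integral_norm_bound_integral i integrable_continuous_interval) auto
  hence "(norm (integral {0..1} f))\<^sup>2 \<le> c\<^sup>2" by (intro power_mono) auto
  also have "c\<^sup>2 \<le> integral {0..1} (\<lambda>v. (norm (f v))\<^sup>2)"
  proof -
    have "0 \<le> integral {0..1} (\<lambda>v. (norm (f v) - c)\<^sup>2)"
      by (rule integral_nonneg) (auto intro!: integrable_continuous_interval continuous_intros f)
    also have "(\<lambda>v. (norm (f v) - c)\<^sup>2) = (\<lambda>v. (norm (f v))\<^sup>2 - 2 * c * norm (f v) + c\<^sup>2)"
      by (simp add: power2_eq_square algebra_simps)
    also have "integral {0..1} \<dots> = integral {0..1} (\<lambda>v. (norm (f v))\<^sup>2) - 2 * c * c + c\<^sup>2"
      using i by (subst integral_add integral_diff, auto intro!: integrable_on_mult_right integrable_diff)+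
         (simp add: c_def)
    finally show ?thesis by (simp add: power2_eq_square)
  qed
  finally show ?thesis .
qed

text \<open>Cauchy-Schwarz in \<open>v\<close> moves the square inside, and exchanging the integrals
  leaves a mean square of \<open>hz_series\<close> at \<open>b + v\<close> for each fixed
  \<open>v\<close>. The weight \<open>1 - v\<close> is at most \<open>1\<close>, and the bound
  decreases in \<open>v\<close>, so its value at \<open>v = 0\<close> serves for all
  \<open>v\<close>. The continuity facts justify the exchange.\<close>

lemma mean_square_hz_remainder:
  assumes \<sigma>: "\<sigma> > 1 / 2" and b: "b \<ge> 1" and T: "T \<ge> 0"
  shows "integral {0..T} (\<lambda>t. (norm (integral {0..1} (\<lambda>v. of_real (1 - v) * hz_series (Complex (\<sigma> + 1) t) (b + v))))\<^sup>2)
    \<le> (T / b\<^sup>2 + 2 * hz_const \<sigma> / b) * hz_tail \<sigma> b"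
    (is "integral _ (\<lambda>t. (norm (integral _ (?F t)))\<^sup>2) \<le> ?B")
proof -
  have C: "continuous_on ({0..T} \<times> {0..1}) (\<lambda>(t, v). hz_series (Complex (\<sigma> + 1) t) (b + v))"
  proof -
    have "continuous_on ({0..T} \<times> {0..1}) (\<lambda>x. (\<lambda>(s, a). hz_series s a) (of_real (\<sigma> + 1) + \<i> * of_real (fst x), b + snd x))"
      by (rule continuous_on_compose2[OF hz_series_continuous]) (use \<sigma> b in \<open>auto intro!: continuous_intros\<close>)
    thus ?thesis by (simp add: case_prod_unfold Complex_eq)
  qed
  have CF: "continuous_on ({0..T} \<times> {0..1}) (\<lambda>(t, v). ?F t v)"
    using C unfolding case_prod_unfold by (intro continuous_intros)
  have Ct: "continuous_on {0..1} (?F t)" if "t \<in> {0..T}" for t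
  proof -
    have "continuous_on {0..1} (\<lambda>v. (\<lambda>(t, v). ?F t v) (t, v))"
      by (rule continuous_on_compose2[OF CF]) (use that in \<open>auto intro!: continuous_intros\<close>)
    thus ?thesis by simp
  qed
  have CF2: "continuous_on (cbox (0, 0) (T, 1)) (\<lambda>(t, v). (norm (?F t v))\<^sup>2)"
  proof -
    have "continuous_on ({0..T} \<times> {0..1}) (\<lambda>x. (norm ((\<lambda>(t, v). ?F t v) x))\<^sup>2)"
      by (intro continuous_intros CF)
    thus ?thesis by (simp add: case_prod_unfold cbox_Pair_eq)
  qed
  have i1: "(\<lambda>t. (norm (integral {0..1} (?F t)))\<^sup>2) integrable_on {0..T}"
    using integral_continuous_on_param[of "{0..T}" 0 1 ?F] CF
    by (intro integrable_continuous_interval continuous_intros) auto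
  have i2: "(\<lambda>t. integral {0..1} (\<lambda>v. (norm (?F t v))\<^sup>2)) integrable_on {0..T}"
    using integral_continuous_on_param[of "{0..T}" 0 1 "\<lambda>t v. (norm (?F t v))\<^sup>2"] CF2
    by (intro integrable_continuous_interval) (auto simp: cbox_Pair_eq)
  have i3: "(\<lambda>v. integral {0..T} (\<lambda>t. (norm (?F t v))\<^sup>2)) integrable_on {0..1}"
  proof (intro integrable_continuous_interval)
    have "continuous_on ({0..1} \<times> cbox 0 T) (\<lambda>(v, t). (norm (?F t v))\<^sup>2)"
    proof -
      have "continuous_on ({0..1} \<times> cbox 0 T) (\<lambda>x. (\<lambda>(t, v). (norm (?F t v))\<^sup>2) (snd x, fst x))"
        by (rule continuous_on_compose2[OF CF2]) (auto simp: cbox_Pair_eq intro!: continuous_intros)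
      thus ?thesis by (simp add: case_prod_unfold)
    qed
    from integral_continuous_on_param[OF this]
    show "continuous_on {0..1} (\<lambda>v. integral {0..T} (\<lambda>t. (norm (?F t v))\<^sup>2))" by simp
  qed
  have "integral {0..T} (\<lambda>t. (norm (integral {0..1} (?F t)))\<^sup>2)
      \<le> integral {0..T} (\<lambda>t. integral {0..1} (\<lambda>v. (norm (?F t v))\<^sup>2))"
    using Ct by (intro integral_le i1 i2 norm_integral_unit_square_le)
  also have "\<dots> = integral {0..1} (\<lambda>v. integral {0..T} (\<lambda>t. (norm (?F t v))\<^sup>2))"
    using integral_swap_continuous[OF CF2] by simp
  also have "\<dots> \<le> integral {0..1} (\<lambda>v::real. ?B)"
  proof (intro integral_le i3)
    fix v :: real assume v: "v \<in> {0..1}"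
    have b0: "b > 0" and bv: "b + v \<ge> 1" "b + v > 0" using b v by auto
    have cv: "continuous_on {0..T} (\<lambda>t. hz_series (Complex (\<sigma> + 1) t) (b + v))"
      by (rule continuous_on_hz_series_vertical) (use \<sigma> bv in auto)
    have "integral {0..T} (\<lambda>t. (norm (?F t v))\<^sup>2) \<le> integral {0..T} (\<lambda>t. (norm (hz_series (Complex (\<sigma> + 1) t) (b + v)))\<^sup>2)"
    proof (intro integral_le integrable_continuous_interval continuous_intros cv power_mono)
      fix t
      show "norm (?F t v) \<le> norm (hz_series (Complex (\<sigma> + 1) t) (b + v))"
        using v by (auto simp: norm_mult intro!: mult_left_le_one_le simp del: of_real_diff)
    qed auto
    also have "\<dots> \<le> (T / (b + v)\<^sup>2 + 2 * hz_const \<sigma> / (b + v)) * hz_tail \<sigma> (b + v)"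
      by (rule mean_square_hz_series[OF \<sigma> bv(1) T])
    also have "\<dots> \<le> ?B"
      using v b0 T hz_const_nonneg[OF \<sigma>] hz_tail_nonneg[OF \<sigma> bv(2)] hz_tail_mono[OF \<sigma> b0, of "b + v"]
      by (intro mult_mono add_mono divide_left_mono power_mono) auto
    finally show "integral {0..T} (\<lambda>t. (norm (?F t v))\<^sup>2) \<le> ?B" .
  qed auto
  finally show ?thesis by simp
qed

section \<open>Mean square distance between the zeta-function and its partial sums\<close>

lemma hz_sum_add: "hz_sum (M + K) a \<sigma> t = hz_sum M a \<sigma> t + hz_sum K (real M + a) \<sigma> t"
proof -
  have "(\<Sum>n<M + K. f n) = (\<Sum>n<M. f n) + (\<Sum>n<K. f (M + n))" for f :: "nat \<Rightarrow> complex"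
    by (induction K) (auto simp: algebra_simps)
  thus ?thesis by (simp add: hz_sum_def add_ac)
qed

lemma norm_add3_square_le:
  fixes x y z :: "'a :: real_normed_vector"
  shows "(norm (x + y + z))\<^sup>2 \<le> 3 * ((norm x)\<^sup>2 + (norm y)\<^sup>2 + (norm z)\<^sup>2)"
proof -
  have "norm (x + y + z) \<le> norm x + norm y + norm z"
    by (intro order_trans[OF norm_triangle_ineq] add_right_mono norm_triangle_ineq)
  hence "(norm (x + y + z))\<^sup>2 \<le> (norm x + norm y + norm z)\<^sup>2" by (intro power_mono) auto
  also have "\<dots> \<le> 3 * ((norm x)\<^sup>2 + (norm y)\<^sup>2 + (norm z)\<^sup>2)"
  proof -
    have "0 \<le> (norm x - norm y)\<^sup>2 + (norm y - norm z)\<^sup>2 + (norm x - norm z)\<^sup>2" by simp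
    thus ?thesis by (simp add: power2_eq_square algebra_simps)
  qed
  finally show ?thesis .
qed

lemma integral_inverse_square_le:
  assumes "T \<ge> (1::real)"
  shows "(\<lambda>t. 1 / t\<^sup>2) integrable_on {1..T}" "integral {1..T} (\<lambda>t. 1 / t\<^sup>2) \<le> 1"
proof -
  have "((\<lambda>t. 1 / t\<^sup>2) has_integral (- 1 / T - (- 1 / 1))) {1..T}"
    using assms
    by (intro fundamental_theorem_of_calculus)
       (auto intro!: derivative_eq_intros simp: power2_eq_square
         simp flip: has_real_derivative_iff_has_vector_derivative)
  thus "(\<lambda>t. 1 / t\<^sup>2) integrable_on {1..T}" "integral {1..T} (\<lambda>t. 1 / t\<^sup>2) \<le> 1"
    using assms by (auto simp: integral_unique intro: has_integral_integrable)
qed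

lemma continuous_on_hurwitz_zeta_vertical:
  assumes "a > 0" "A \<subseteq> {0<..}"
  shows "continuous_on A (\<lambda>t. hurwitz_zeta a (Complex \<sigma> t))"
proof (rule continuous_on_compose2[OF holomorphic_on_imp_continuous_on[OF hurwitz_zeta_holomorphic[OF assms(1)]]])
  show "continuous_on A (Complex \<sigma>)"
    unfolding Complex_eq by (intro continuous_intros)
qed (use assms(2) in \<open>force simp: complex_eq_iff\<close>)

text \<open>The three summands of the bound belong to the terms \<open>M <= n < N\<close> with
  \<open>N = nat \<lfloor>T\<rfloor>\<close>, to the pole term, and to the Euler-Maclaurin
  remainder. The factor \<open>s\<close> of the remainder costs \<open>T^2\<close> in mean square,
  but the mean square of the integral is of order \<open>1 / T\<close> times a tail. Integration
  starts at \<open>1\<close> because for \<open>\<sigma> = 1\<close> the pole lies on the line at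
  \<open>t = 0\<close>.\<close>

lemma mean_square_hurwitz_zeta_minus_sum:
  assumes \<sigma>: "\<sigma> > 1 / 2" and a: "a > 0" and M: "M \<ge> 1" and T: "T \<ge> real M" "T \<ge> a"
  shows "integral {1..T} (\<lambda>t. (norm (hurwitz_zeta a (Complex \<sigma> t) - hz_sum M a \<sigma> t))\<^sup>2) \<le>
    3 * ((1 + 4 * hz_const \<sigma>) * T * hz_tail \<sigma> (real M + a) + (1 + (2 * T) powr (2 - 2 * \<sigma>)) +
      (\<sigma> + 1)\<^sup>2 * (4 + 4 * hz_const \<sigma>) * T * hz_tail \<sigma> (real (nat \<lfloor>T\<rfloor>) + a))"
proof -
  define N where "N = nat \<lfloor>T\<rfloor>"
  define b where "b = real N + a"
  have MN: "M \<le> N" using T unfolding N_def by linarith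
  have T1: "T \<ge> 1" using T M by linarith
  have "\<lfloor>T\<rfloor> \<ge> 1" using T1 by simp
  hence NT: "real N \<le> T" "real N \<ge> T / 2" "N \<ge> 1" unfolding N_def by linarith+
  \<comment> \<open>So \<open>b\<close> has the order of \<open>T\<close> on both sides:
    \<open>N >= T / 2\<close> because \<open>N >= 1\<close>, and \<open>b <= 2 * T\<close> because
    \<open>T >= a\<close>.\<close>
  have b: "b \<ge> 1" "b > 0" "b \<ge> T / 2" "b \<le> 2 * T" using NT a T unfolding b_def by linarith+
  have C: "hz_const \<sigma> \<ge> 0" by (rule hz_const_nonneg[OF \<sigma>])
  let ?R = "\<lambda>t. integral {0..1} (\<lambda>v. of_real (1 - v) * hz_series (Complex (\<sigma> + 1) t) (b + v))"
  let ?x = "\<lambda>t. hz_sum (N - M) (real M + a) \<sigma> t"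
  let ?y = "\<lambda>t. of_real b powr (1 - Complex \<sigma> t) / (Complex \<sigma> t - 1)"
  let ?z = "\<lambda>t. Complex \<sigma> t * ?R t"
  have decomp: "hurwitz_zeta a (Complex \<sigma> t) - hz_sum M a \<sigma> t = ?x t + ?y t + ?z t" if "t \<ge> 1" for t
  proof -
    have "Complex \<sigma> t + 1 = Complex (\<sigma> + 1) t" by (simp add: complex_eq_iff)
    moreover have "Complex \<sigma> t \<noteq> 1" using that by (auto simp: complex_eq_iff)
    ultimately have "hurwitz_zeta a (Complex \<sigma> t) = hz_sum N a \<sigma> t + ?y t + ?z t"
      using hurwitz_zeta_Euler_Maclaurin[OF a, of "Complex \<sigma> t" N] \<sigma>
      by (simp add: hz_sum_def b_def add_ac)
    moreover have "hz_sum N a \<sigma> t = hz_sum M a \<sigma> t + ?x t"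
      using hz_sum_add[of M "N - M"] MN by simp
    ultimately show ?thesis by simp
  qed
  have cR: "continuous_on {0..T} ?R"
  proof -
    have "continuous_on ({0..T} \<times> {0..1}) (\<lambda>x. (\<lambda>(s, a). hz_series s a) (of_real (\<sigma> + 1) + \<i> * of_real (fst x), b + snd x))"
      by (rule continuous_on_compose2[OF hz_series_continuous]) (use \<sigma> b in \<open>auto intro!: continuous_intros\<close>)
    hence "continuous_on ({0..T} \<times> cbox 0 1) (\<lambda>(t, v). of_real (1 - v) * hz_series (Complex (\<sigma> + 1) t) (b + v))"
      unfolding case_prod_unfold by (intro continuous_intros) (simp_all add: case_prod_unfold Complex_eq)
    from integral_continuous_on_param[OF this] show ?thesis by simp
  qed
  have s1: "Complex \<sigma> t \<noteq> 1" if "t \<ge> 1" for t using that by (auto simp: complex_eq_iff)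
  have cC: "continuous_on A (Complex \<sigma>)" for A unfolding Complex_eq by (intro continuous_intros)
  have cx: "continuous_on A ?x" for A using a by (intro continuous_intros) auto
  have cy: "continuous_on {1..T} ?y" using b s1 by (intro continuous_intros cC) auto
  have cz: "continuous_on {1..T} ?z" by (intro continuous_intros cC continuous_on_subset[OF cR]) auto
  have X: "integral {1..T} (\<lambda>t. (norm (?x t))\<^sup>2) \<le> (1 + 4 * hz_const \<sigma>) * T * hz_tail \<sigma> (real M + a)"
  proof -
    have "integral {1..T} (\<lambda>t. (norm (?x t))\<^sup>2) \<le> integral {0..T} (\<lambda>t. (norm (?x t))\<^sup>2)"
      by (intro integral_subset_le integrable_continuous_interval continuous_intros cx) auto
    also have "\<dots> \<le> (T + 2 * hz_const \<sigma> * (real (N - M) + (real M + a))) *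
        (\<Sum>n<N - M. (real n + (real M + a)) powr (- (\<sigma> + 1 / 2)))"
      by (rule mean_square_hz_sum[OF \<sigma>]) (use a M T1 in auto)
    also have "\<dots> \<le> (T + 2 * hz_const \<sigma> * (2 * T)) * hz_tail \<sigma> (real M + a)"
      using MN b C T1 a
      by (intro mult_mono add_mono sum_le_hz_tail[OF \<sigma>] sum_nonneg) (auto simp: b_def of_nat_diff)
    finally show ?thesis by (simp add: algebra_simps)
  qed
  have Y: "integral {1..T} (\<lambda>t. (norm (?y t))\<^sup>2) \<le> 1 + (2 * T) powr (2 - 2 * \<sigma>)"
  proof -
    have "(norm (?y t))\<^sup>2 \<le> b powr (2 - 2 * \<sigma>) * (1 / t\<^sup>2)" if "t \<ge> 1" for t
    proof -
      have "\<bar>Im (Complex \<sigma> t - 1)\<bar> \<le> norm (Complex \<sigma> t - 1)" by (rule abs_Im_le_cmod)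
      hence "t \<le> norm (Complex \<sigma> t - 1)" by simp
      hence "norm (?y t) \<le> b powr (1 - \<sigma>) / t"
        using that b s1[OF that] by (auto simp: norm_divide norm_powr_real_powr intro!: divide_left_mono mult_pos_pos)
      hence "(norm (?y t))\<^sup>2 \<le> (b powr (1 - \<sigma>) / t)\<^sup>2" by (intro power_mono) auto
      also have "\<dots> = b powr (2 - 2 * \<sigma>) * (1 / t\<^sup>2)"
        by (simp add: power2_eq_square flip: powr_add)
      finally show ?thesis .
    qed
    hence "integral {1..T} (\<lambda>t. (norm (?y t))\<^sup>2) \<le> integral {1..T} (\<lambda>t. b powr (2 - 2 * \<sigma>) * (1 / t\<^sup>2))"
      by (intro integral_le integrable_continuous_interval[of 1 T "\<lambda>t. (norm (?y t))\<^sup>2"] continuous_intros cy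
            integrable_on_mult_right integral_inverse_square_le T1) auto
    also have "\<dots> = b powr (2 - 2 * \<sigma>) * integral {1..T} (\<lambda>t. 1 / t\<^sup>2)" by (rule integral_mult_right)
    also have "\<dots> \<le> b powr (2 - 2 * \<sigma>) * 1" by (intro mult_left_mono integral_inverse_square_le T1) auto
    also have "\<dots> \<le> 1 + (2 * T) powr (2 - 2 * \<sigma>)"
    \<comment> \<open>The exponent changes sign at \<open>\<sigma> = 1\<close>. The summand
      \<open>1\<close> covers \<open>\<sigma> >= 1\<close>, where \<open>b >= 1\<close> suffices;
      the power of \<open>2 * T\<close> covers the rest.\<close>
    proof (cases "\<sigma> \<ge> 1")
      case True
      have "b powr (2 - 2 * \<sigma>) \<le> b powr 0" using True b by (intro powr_mono) auto
      thus ?thesis using b by (simp add: add_increasing2)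
    next
      case False
      have "b powr (2 - 2 * \<sigma>) \<le> (2 * T) powr (2 - 2 * \<sigma>)" using False b by (intro powr_mono2) auto
      thus ?thesis by simp
    qed
    finally show ?thesis .
  qed
  have Z: "integral {1..T} (\<lambda>t. (norm (?z t))\<^sup>2) \<le> (\<sigma> + 1)\<^sup>2 * (4 + 4 * hz_const \<sigma>) * T * hz_tail \<sigma> b"
  proof -
    have iR: "(\<lambda>t. ((\<sigma> + 1) * T)\<^sup>2 * (norm (?R t))\<^sup>2) integrable_on {0..T}"
      by (intro integrable_continuous_interval continuous_intros cR)
    have "integral {1..T} (\<lambda>t. (norm (?z t))\<^sup>2) \<le> integral {1..T} (\<lambda>t. ((\<sigma> + 1) * T)\<^sup>2 * (norm (?R t))\<^sup>2)"
    proof (rule integral_le)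
      fix t assume t: "t \<in> {1..T}"
      have "norm (Complex \<sigma> t) \<le> \<bar>\<sigma>\<bar> + \<bar>t\<bar>" using cmod_le[of "Complex \<sigma> t"] by simp
      also have "\<dots> \<le> \<sigma> * T + T" using t \<sigma> T1 by (intro add_mono) (auto simp: mult_le_cancel_left1)
      finally show "(norm (?z t))\<^sup>2 \<le> ((\<sigma> + 1) * T)\<^sup>2 * (norm (?R t))\<^sup>2"
        unfolding norm_mult power_mult_distrib[of _ "norm (?R t)"]
        by (intro mult_right_mono power_mono) (auto simp: algebra_simps)
    qed (intro integrable_continuous_interval continuous_intros cz continuous_on_subset[OF cR] | auto)+
    also have "\<dots> \<le> integral {0..T} (\<lambda>t. ((\<sigma> + 1) * T)\<^sup>2 * (norm (?R t))\<^sup>2)"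
      by (intro integral_subset_le iR integrable_on_subinterval[OF iR]) auto
    also have "\<dots> = ((\<sigma> + 1) * T)\<^sup>2 * integral {0..T} (\<lambda>t. (norm (?R t))\<^sup>2)" by (rule integral_mult_right)
    also have "\<dots> \<le> ((\<sigma> + 1) * T)\<^sup>2 * ((T / b\<^sup>2 + 2 * hz_const \<sigma> / b) * hz_tail \<sigma> b)"
      by (intro mult_left_mono mean_square_hz_remainder \<sigma>) (use b T1 in auto)
    \<comment> \<open>Replacing \<open>b\<close> by \<open>T / 2\<close> makes the bracket equal to
      \<open>(4 + 4 * hz_const \<sigma>) / T\<close>, which cancels one of the two factors
      \<open>T\<close>.\<close>
    also have "\<dots> \<le> ((\<sigma> + 1) * T)\<^sup>2 * ((T / (T / 2)\<^sup>2 + 2 * hz_const \<sigma> / (T / 2)) * hz_tail \<sigma> b)"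
      using b T1 C hz_tail_nonneg[OF \<sigma> b(2)]
      by (intro mult_left_mono mult_right_mono add_mono divide_left_mono power_mono) auto
    also have "\<dots> = (\<sigma> + 1)\<^sup>2 * (4 + 4 * hz_const \<sigma>) * T * hz_tail \<sigma> b"
      using T1 by (simp add: power2_eq_square field_simps)
    finally show ?thesis .
  qed
  have "integral {1..T} (\<lambda>t. (norm (hurwitz_zeta a (Complex \<sigma> t) - hz_sum M a \<sigma> t))\<^sup>2) \<le>
      integral {1..T} (\<lambda>t. 3 * ((norm (?x t))\<^sup>2 + (norm (?y t))\<^sup>2 + (norm (?z t))\<^sup>2))"
  proof (rule integral_le)
    show "(\<lambda>t. (norm (hurwitz_zeta a (Complex \<sigma> t) - hz_sum M a \<sigma> t))\<^sup>2) integrable_on {1..T}"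
      using a by (intro integrable_continuous_interval continuous_intros continuous_on_hurwitz_zeta_vertical) auto
    show "(\<lambda>t. 3 * ((norm (?x t))\<^sup>2 + (norm (?y t))\<^sup>2 + (norm (?z t))\<^sup>2)) integrable_on {1..T}"
      by (intro integrable_continuous_interval continuous_on_mult continuous_on_add continuous_on_const
            continuous_on_power continuous_on_norm cx cy cz)
  qed (simp only: decomp norm_add3_square_le atLeastAtMost_iff)
  also have "\<dots> = 3 * (integral {1..T} (\<lambda>t. (norm (?x t))\<^sup>2) + integral {1..T} (\<lambda>t. (norm (?y t))\<^sup>2) +
      integral {1..T} (\<lambda>t. (norm (?z t))\<^sup>2))"
  proof -
    have i: "(\<lambda>t. (norm (?x t))\<^sup>2) integrable_on {1..T}" "(\<lambda>t. (norm (?y t))\<^sup>2) integrable_on {1..T}"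
      "(\<lambda>t. (norm (?z t))\<^sup>2) integrable_on {1..T}"
      by (rule integrable_continuous_interval, rule continuous_on_power, rule continuous_on_norm, rule cx cy cz)+
    show ?thesis
      unfolding integral_mult_right integral_add[OF integrable_add[OF i(1,2)] i(3)] integral_add[OF i(1,2)] ..
  qed
  also have "\<dots> \<le> 3 * ((1 + 4 * hz_const \<sigma>) * T * hz_tail \<sigma> (real M + a) + (1 + (2 * T) powr (2 - 2 * \<sigma>)) +
      (\<sigma> + 1)\<^sup>2 * (4 + 4 * hz_const \<sigma>) * T * hz_tail \<sigma> b)"
    by (intro mult_left_mono add_mono X Y Z) auto
  finally show ?thesis by (simp add: b_def N_def)
qed

text \<open>After division by \<open>T\<close> the first summand of the preceding bound depends on
  \<open>M\<close> alone and is below \<open>\<epsilon> / 2\<close> for large \<open>M\<close>. The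
  other two vanish as \<open>T\<close> grows: the pole term is
  \<open>O(1 / T + T^(1 - 2 * \<sigma>))\<close> and the remainder is a tail starting near
  \<open>T\<close>. Hence \<open>M\<close> is chosen first and \<open>T\<close> afterwards.\<close>

lemma hurwitz_zeta_mean_square_approx:
  assumes \<sigma>: "\<sigma> > 1 / 2" and a: "a > 0" and \<epsilon>: "\<epsilon> > 0"
  shows "\<forall>\<^sub>F M in sequentially. \<forall>\<^sub>F T in at_top.
    integral {1..T} (\<lambda>t. (norm (hurwitz_zeta a (Complex \<sigma> t) - hz_sum M a \<sigma> t))\<^sup>2) \<le> \<epsilon> * T"
proof -
  have "(\<lambda>M. 3 * ((1 + 4 * hz_const \<sigma>) * hz_tail \<sigma> (real M + a))) \<longlonglongrightarrow> 3 * ((1 + 4 * hz_const \<sigma>) * 0)"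
    by (intro tendsto_intros hz_tail_tendsto_0 \<sigma> a)
  hence "\<forall>\<^sub>F M in sequentially. 3 * ((1 + 4 * hz_const \<sigma>) * hz_tail \<sigma> (real M + a)) < \<epsilon> / 2"
    by (rule order_tendstoD) (use \<epsilon> in auto)
  thus ?thesis using eventually_ge_at_top[of 1]
  proof eventually_elim
    case (elim M)
    have nf: "filterlim (\<lambda>T::real. nat \<lfloor>T\<rfloor>) at_top at_top"
      by (intro filterlim_compose[OF filterlim_nat_sequentially filterlim_floor_sequentially])
    have tl: "((\<lambda>T::real. hz_tail \<sigma> (real (nat \<lfloor>T\<rfloor>) + a)) \<longlongrightarrow> 0) at_top"
      by (rule filterlim_compose[OF hz_tail_tendsto_0[OF \<sigma> a] nf])
    have "((\<lambda>T::real. 3 * ((\<sigma> + 1)\<^sup>2 * (4 + 4 * hz_const \<sigma>) * hz_tail \<sigma> (real (nat \<lfloor>T\<rfloor>) + a))) \<longlongrightarrow>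
        3 * ((\<sigma> + 1)\<^sup>2 * (4 + 4 * hz_const \<sigma>) * 0)) at_top"
      by (intro tendsto_intros tl)
    moreover have "((\<lambda>T::real. 3 * ((1 + (2 * T) powr (2 - 2 * \<sigma>)) / T)) \<longlongrightarrow> 0) at_top"
    proof (rule Lim_transform_eventually)
      have "((\<lambda>T. T powr (1 - 2 * \<sigma>)) \<longlongrightarrow> 0) at_top"
        by (rule tendsto_neg_powr) (use \<sigma> in \<open>auto simp: filterlim_ident\<close>)
      moreover have "((\<lambda>T::real. 1 / T) \<longlongrightarrow> 0) at_top" by real_asymp
      ultimately have "((\<lambda>T. 3 * (1 / T + 2 powr (2 - 2 * \<sigma>) * T powr (1 - 2 * \<sigma>))) \<longlongrightarrow>
          3 * (0 + 2 powr (2 - 2 * \<sigma>) * 0)) at_top"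
        by (intro tendsto_intros)
      thus "((\<lambda>T. 3 * (1 / T + 2 powr (2 - 2 * \<sigma>) * T powr (1 - 2 * \<sigma>))) \<longlongrightarrow> 0) at_top" by simp
      show "\<forall>\<^sub>F T in at_top. 3 * (1 / T + 2 powr (2 - 2 * \<sigma>) * T powr (1 - 2 * \<sigma>)) =
          3 * ((1 + (2 * T) powr (2 - 2 * \<sigma>)) / T)"
        using eventually_gt_at_top[of 0]
      proof eventually_elim
        case (elim T)
        hence "T powr (1 - 2 * \<sigma>) = T powr (2 - 2 * \<sigma>) / T"
          using powr_diff[of T "2 - 2 * \<sigma>" 1] by simp
        thus ?case using elim by (simp add: powr_mult add_divide_distrib)
      qed
    qed
    ultimately have "((\<lambda>T::real. 3 * ((1 + (2 * T) powr (2 - 2 * \<sigma>)) / T) +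
         3 * ((\<sigma> + 1)\<^sup>2 * (4 + 4 * hz_const \<sigma>) * hz_tail \<sigma> (real (nat \<lfloor>T\<rfloor>) + a))) \<longlongrightarrow> 0) at_top"
      by (auto intro: tendsto_add_zero)
    hence "\<forall>\<^sub>F T in at_top. 3 * ((1 + (2 * T) powr (2 - 2 * \<sigma>)) / T) +
         3 * ((\<sigma> + 1)\<^sup>2 * (4 + 4 * hz_const \<sigma>) * hz_tail \<sigma> (real (nat \<lfloor>T\<rfloor>) + a)) < \<epsilon> / 2"
      by (rule order_tendstoD) (use \<epsilon> in auto)
    thus ?case using eventually_ge_at_top[of "real M"] eventually_ge_at_top[of a]
    proof eventually_elim
      case (elim T)
      have T: "T > 0" using elim a by linarith
      let ?U = "(1 + (2 * T) powr (2 - 2 * \<sigma>))" and ?V = "(\<sigma> + 1)\<^sup>2 * (4 + 4 * hz_const \<sigma>) * hz_tail \<sigma> (real (nat \<lfloor>T\<rfloor>) + a)"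
        and ?W = "(1 + 4 * hz_const \<sigma>) * hz_tail \<sigma> (real M + a)"
      have "integral {1..T} (\<lambda>t. (norm (hurwitz_zeta a (Complex \<sigma> t) - hz_sum M a \<sigma> t))\<^sup>2) \<le>
        (3 * ?W + (3 * (?U / T) + 3 * ?V)) * T"
      proof -
        have *: "3 * (p * T * h + u + q * T * k) = (3 * (p * h) + (3 * (u / T) + 3 * (q * k))) * T" for p h u q k
          using T by (simp add: field_simps)
        show ?thesis
          using mean_square_hurwitz_zeta_minus_sum[OF \<sigma> a \<open>1 \<le> M\<close> elim(2,3)] unfolding * .
      qed
      also have "\<dots> \<le> \<epsilon> * T"
      proof (rule mult_right_mono)
        show "3 * ?W + (3 * (?U / T) + 3 * ?V) \<le> \<epsilon>" using elim(1) \<open>3 * ?W < \<epsilon> / 2\<close> by linarith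
      qed (use T in simp)
      finally show ?case .
    qed
  qed
qed

section \<open>Time means of trigonometric polynomials\<close>

text \<open>
  Laurent polynomials on the torus. The rule \<open>cong\<close> forgets values off the torus, which makes the
  set closed under products and complex conjugation.
\<close>

inductive_set trig_poly :: "nat \<Rightarrow> ((nat \<Rightarrow> complex) \<Rightarrow> complex) set" for N where
  monomial: "(\<lambda>w. c * (\<Prod>n<N. w n powi e n)) \<in> trig_poly N"
| add: "p \<in> trig_poly N \<Longrightarrow> q \<in> trig_poly N \<Longrightarrow> (\<lambda>w. p w + q w) \<in> trig_poly N"
| cong: "p \<in> trig_poly N \<Longrightarrow> (\<And>w. (\<forall>n<N. norm (w n) = 1) \<Longrightarrow> q w = p w) \<Longrightarrow> q \<in> trig_poly N"

lemma trig_poly_const: "(\<lambda>w. c) \<in> trig_poly N"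
  using trig_poly.monomial[of c "\<lambda>_. 0" N] by simp

text \<open>Induction on both factors reduces the claim to two monomials, whose exponents add.
  Adding integer exponents requires nonzero variables, which holds on the torus, so
  \<open>cong\<close> applies.\<close>

lemma trig_poly_mult:
  assumes "p \<in> trig_poly N" "q \<in> trig_poly N"
  shows "(\<lambda>w. p w * q w) \<in> trig_poly N"
  using assms(1)
proof induction
  case (monomial c e)
  from assms(2) show ?case
  proof induction
    case m2: (monomial d f)
    show ?case
    proof (rule trig_poly.cong[OF trig_poly.monomial[of "c * d" "\<lambda>n. e n + f n"]])
      fix w :: "nat \<Rightarrow> complex" assume "\<forall>n<N. norm (w n) = 1"
      hence "w n \<noteq> 0" if "n < N" for n using that by (metis norm_zero zero_neq_one)
      thus "c * (\<Prod>n<N. w n powi e n) * (d * (\<Prod>n<N. w n powi f n)) = c * d * (\<Prod>n<N. w n powi (e n + f n))"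
        by (simp add: power_int_add prod.distrib mult_ac)
    qed
  next
    case (add p q)
    show ?case using trig_poly.add[OF add.IH] by (simp add: algebra_simps)
  next
    case (cong p q)
    show ?case by (rule trig_poly.cong[OF cong.IH]) (simp add: cong.hyps)
  qed
next
  case (add p' q')
  show ?case using trig_poly.add[OF add.IH] by (simp add: algebra_simps)
next
  case (cong p' q')
  show ?case by (rule trig_poly.cong[OF cong.IH]) (simp add: cong.hyps)
qed

lemma trig_poly_sum: "(\<And>i. i < (K :: nat) \<Longrightarrow> p i \<in> trig_poly N) \<Longrightarrow> (\<lambda>w. \<Sum>i<K. p i w) \<in> trig_poly N"
  by (induction K) (auto intro: trig_poly.add trig_poly_const)

text \<open>Exponent vectors supported at \<open>n\<close> give the variable and its inverse; on the
  unit circle the inverse is the conjugate.\<close>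

lemma trig_poly_var:
  assumes "n < N"
  shows "(\<lambda>w. w n) \<in> trig_poly N" "(\<lambda>w. cnj (w n)) \<in> trig_poly N"
proof -
  have *: "(\<Prod>i<N. w i powi (if i = n then k else 0)) = w n powi k" for w :: "nat \<Rightarrow> complex" and k
  proof -
    have "(\<Prod>i<N. w i powi (if i = n then k else 0)) = (\<Prod>i<N. if i = n then w i powi k else 1)"
      by (intro prod.cong) auto
    thus ?thesis using assms by simp
  qed
  show "(\<lambda>w. w n) \<in> trig_poly N"
    using trig_poly.monomial[of 1 "\<lambda>i. if i = n then 1 else 0" N] by (simp add: *)
  have "(\<lambda>w. w n powi (-1)) \<in> trig_poly N"
    using trig_poly.monomial[of 1 "\<lambda>i. if i = n then -1 else 0" N] by (simp only: * mult_1)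
  thus "(\<lambda>w. cnj (w n)) \<in> trig_poly N"
  proof (rule trig_poly.cong)
    fix w :: "nat \<Rightarrow> complex" assume "\<forall>n<N. norm (w n) = 1"
    thus "cnj (w n) = w n powi (-1)"
      using assms complex_div_cnj[of 1 "w n"] by (simp add: power_int_minus divide_inverse)
  qed
qed

text \<open>Real polynomial functions on the plane are generated by constants and real-linear
  functionals, so with closure under sums and products only the linear case needs an
  argument.\<close>

lemma trig_poly_real_polynomial_function:
  assumes "real_polynomial_function g"
  shows "(\<lambda>w. of_real (g (\<Sum>n<N. of_real (a n) * w n))) \<in> trig_poly N"
  using assms
proof induction
  case (linear f)
  let ?S = "\<lambda>w. \<Sum>n<N. of_real (a n) * w n" and ?S' = "\<lambda>w. \<Sum>n<N. of_real (a n) * cnj (w n)"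
  \<comment> \<open>This is \<open>f z = f 1 * Re z + f \<i> * Im z\<close> with the real and
    imaginary parts written through \<open>z\<close> and \<open>cnj z\<close>.\<close>
  have "(\<lambda>w. of_real (f 1) * (1 / 2) * (?S w + ?S' w) + of_real (f \<i>) * (- \<i> / 2) * (?S w + (-1) * ?S' w)) \<in> trig_poly N"
    by (intro trig_poly.add trig_poly_mult trig_poly_const trig_poly_sum trig_poly_var)
  thus ?case
  proof (rule trig_poly.cong)
    fix w :: "nat \<Rightarrow> complex"
    define z where "z = ?S w"
    have z': "?S' w = cnj z" by (simp add: z_def)
    interpret bounded_linear f by fact
    have "z = Re z *\<^sub>R 1 + Im z *\<^sub>R \<i>" by (simp add: complex_eq_iff)
    hence "f z = Re z * f 1 + Im z * f \<i>" by (metis add scaleR real_scaleR_def)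
    thus "complex_of_real (f (?S w)) = of_real (f 1) * (1 / 2) * (?S w + ?S' w) + of_real (f \<i>) * (- \<i> / 2) * (?S w + (-1) * ?S' w)"
      unfolding z' z_def[symmetric] by (simp add: complex_eq_iff)
  qed
qed (auto intro: trig_poly.add trig_poly_mult trig_poly_const)

section \<open>Limits of time means\<close>

definition time_mean :: "(real \<Rightarrow> 'b :: real_normed_vector) \<Rightarrow> real \<Rightarrow> 'b" where
  "time_mean f T = (1 / T) *\<^sub>R integral {0..T} f"

text \<open>For nonzero \<open>L\<close> the integral of the oscillating exponential stays bounded,
  so its mean is \<open>O(1 / T)\<close>. The values \<open>0\<close> and \<open>1\<close> are the
  ones prescribed for the moments of the random model.\<close>

lemma time_mean_cis:
  "((\<lambda>T. time_mean (\<lambda>t. cis (t * L)) T) \<longlongrightarrow> (if L = 0 then 1 else 0)) at_top"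
proof (cases "L = 0")
  case True
  have "\<forall>\<^sub>F T in at_top. (1 :: complex) = time_mean (\<lambda>t. cis (t * L)) T"
    using eventually_gt_at_top[of 0] by eventually_elim (simp add: True time_mean_def)
  thus ?thesis using True by (auto intro: tendsto_eventually elim: eventually_mono)
next
  case False
  define c where "c = \<i> * of_real L"
  have c: "c \<noteq> 0" using False by (simp add: c_def)
  have cis: "cis (t * L) = exp (c * of_real t)" for t by (simp add: cis_conv_exp c_def mult_ac)
  have I: "((\<lambda>t. cis (t * L)) has_integral (exp (c * of_real T) / c - exp (c * of_real 0) / c)) {0..T}"
    if "T \<ge> 0" for T
    unfolding cis
  proof (rule fundamental_theorem_of_calculus[OF that])
    fix t
    have "((\<lambda>z. exp (c * z) / c) has_field_derivative exp (c * of_real t)) (at (of_real t))"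
      using c by (auto intro!: derivative_eq_intros)
    thus "((\<lambda>t. exp (c * of_real t) / c) has_vector_derivative exp (c * of_real t)) (at t within {0..T})"
      by (rule has_vector_derivative_real_field[THEN has_vector_derivative_at_within])
  qed
  have "\<forall>\<^sub>F T in at_top. norm (time_mean (\<lambda>t. cis (t * L)) T) \<le> 2 / norm c / T"
    using eventually_gt_at_top[of 0]
  proof eventually_elim
    case (elim T)
    have "norm (exp (c * of_real T) - 1) \<le> norm (exp (c * of_real T)) + norm (1 :: complex)"
      by (rule norm_triangle_ineq4)
    also have "\<dots> = 2" by (simp flip: cis)
    finally have "norm (exp (c * of_real T) - 1) \<le> 2" .
    hence "norm (exp (c * of_real T) - 1) / (T * norm c) \<le> 2 / (T * norm c)"
      using elim by (intro divide_right_mono) auto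
    thus ?case using integral_unique[OF I[of T]] elim
      by (simp add: time_mean_def norm_divide mult.commute flip: diff_divide_distrib)
  qed
  moreover have "((\<lambda>T. 2 / norm c / T) \<longlongrightarrow> 0) at_top" by real_asymp
  ultimately show ?thesis using False by (auto intro: Lim_null_comparison)
qed

text \<open>Induction on the generation of \<open>p\<close>. Continuity and integrability are
  carried along because additivity of the two kinds of integral requires them. In the case
  \<open>cong\<close> both \<open>u t\<close> and the values of the \<open>X n\<close> lie on the
  torus.\<close>

lemma trig_poly_time_mean:
  fixes u :: "real \<Rightarrow> nat \<Rightarrow> complex" and X :: "nat \<Rightarrow> 'a \<Rightarrow> complex"
  assumes "prob_space M"
    and X: "\<And>n. X n \<in> borel_measurable M" "\<And>n \<omega>. \<omega> \<in> space M \<Longrightarrow> norm (X n \<omega>) = 1"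
    and u: "\<And>n. continuous_on UNIV (\<lambda>t. u t n)" "\<And>t n. norm (u t n) = 1"
    and mono: "\<And>e. ((\<lambda>T. time_mean (\<lambda>t. \<Prod>n<N. u t n powi e n) T) \<longlongrightarrow> (\<integral>\<omega>. (\<Prod>n<N. X n \<omega> powi e n) \<partial>M)) at_top"
    and p: "p \<in> trig_poly N"
  shows "continuous_on UNIV (\<lambda>t. p (u t)) \<and> integrable M (\<lambda>\<omega>. p (\<lambda>n. X n \<omega>)) \<and>
    ((\<lambda>T. time_mean (\<lambda>t. p (u t)) T) \<longlongrightarrow> (\<integral>\<omega>. p (\<lambda>n. X n \<omega>) \<partial>M)) at_top"
  using p
proof induction
  case (monomial c e)
  interpret prob_space M by fact
  note [measurable] = X(1)
  have [measurable]: "(\<lambda>\<omega>. X n \<omega> powi k) \<in> borel_measurable M" for n k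
    by (cases "k \<ge> 0") (auto simp: power_int_def)
  have 1: "continuous_on UNIV (\<lambda>t. c * (\<Prod>n<N. u t n powi e n))"
    using u by (auto intro!: continuous_intros) (metis norm_zero zero_neq_one)
  moreover have "integrable M (\<lambda>\<omega>. c * (\<Prod>n<N. X n \<omega> powi e n))"
    by (rule integrable_const_bound[of _ "norm c"]) (auto simp: norm_mult prod_norm[symmetric] norm_power_int X(2))
  moreover have "((\<lambda>T. c * time_mean (\<lambda>t. \<Prod>n<N. u t n powi e n) T) \<longlongrightarrow> c * (\<integral>\<omega>. (\<Prod>n<N. X n \<omega> powi e n) \<partial>M)) at_top"
    by (intro tendsto_intros mono)
  ultimately show ?case by (simp add: time_mean_def)
next
  case (add p q)
  have "((\<lambda>T. time_mean (\<lambda>t. p (u t)) T + time_mean (\<lambda>t. q (u t)) T) \<longlongrightarrow>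
     (\<integral>\<omega>. p (\<lambda>n. X n \<omega>) \<partial>M) + (\<integral>\<omega>. q (\<lambda>n. X n \<omega>) \<partial>M)) at_top"
    by (intro tendsto_intros) (use add.IH in auto)
  moreover have "time_mean (\<lambda>t. p (u t) + q (u t)) T = time_mean (\<lambda>t. p (u t)) T + time_mean (\<lambda>t. q (u t)) T" for T
    using add.IH by (simp add: time_mean_def integral_add integrable_continuous_interval
      continuous_on_subset[of UNIV] scaleR_add_right)
  ultimately show ?case using add.IH by (auto intro!: continuous_intros)
next
  case (cong p q)
  have 1: "(\<lambda>t. q (u t)) = (\<lambda>t. p (u t))" using cong.hyps(2) u(2) by auto
  have 2: "q (\<lambda>n. X n \<omega>) = p (\<lambda>n. X n \<omega>)" if "\<omega> \<in> space M" for \<omega>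
    using cong.hyps(2) X(2)[OF that] by auto
  have "integrable M (\<lambda>\<omega>. q (\<lambda>n. X n \<omega>)) \<longleftrightarrow> integrable M (\<lambda>\<omega>. p (\<lambda>n. X n \<omega>))"
    by (intro Bochner_Integration.integrable_cong 2 refl)
  moreover have "(\<integral>\<omega>. q (\<lambda>n. X n \<omega>) \<partial>M) = (\<integral>\<omega>. p (\<lambda>n. X n \<omega>) \<partial>M)"
    by (intro Bochner_Integration.integral_cong 2 refl)
  ultimately show ?case using cong.IH unfolding 1 by simp
qed

lemma time_mean_diff_le:
  fixes f g :: "real \<Rightarrow> real"
  assumes "T > 0" "continuous_on {0..T} f" "continuous_on {0..T} g" "\<And>t. \<bar>f t - g t\<bar> \<le> e"
  shows "\<bar>time_mean f T - time_mean g T\<bar> \<le> e"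
proof -
  have i: "f integrable_on {0..T}" "g integrable_on {0..T}"
    using assms by (auto intro: integrable_continuous_interval)
  have "norm (integral {0..T} (\<lambda>t. f t - g t)) \<le> integral {0..T} (\<lambda>t. e)"
    by (rule integral_norm_bound_integral) (use i assms(4) in \<open>auto intro: integrable_diff\<close>)
  thus ?thesis using assms(1) i
    by (simp add: time_mean_def integral_diff abs_mult field_simps flip: right_diff_distrib)
qed

text \<open>All values of the polynomial lie in the disc of radius \<open>r\<close>, where
  Stone-Weierstrass replaces \<open>f\<close> by a real polynomial function at a cost of
  \<open>\<epsilon> / 4\<close> on each side. Only values on this disc enter, so the result applies
  to unbounded functions such as the squared norm.\<close>

lemma continuous_time_mean:
  fixes u :: "real \<Rightarrow> nat \<Rightarrow> complex" and X :: "nat \<Rightarrow> 'a \<Rightarrow> complex" and f :: "complex \<Rightarrow> real"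
  assumes "prob_space M"
    and X: "\<And>n. X n \<in> borel_measurable M" "\<And>n \<omega>. \<omega> \<in> space M \<Longrightarrow> norm (X n \<omega>) = 1"
    and u: "\<And>n. continuous_on UNIV (\<lambda>t. u t n)" "\<And>t n. norm (u t n) = 1"
    and mono: "\<And>e. ((\<lambda>T. time_mean (\<lambda>t. \<Prod>n<N. u t n powi e n) T) \<longlongrightarrow> (\<integral>\<omega>. (\<Prod>n<N. X n \<omega> powi e n) \<partial>M)) at_top"
    and f: "continuous_on UNIV f"
  shows "((\<lambda>T. time_mean (\<lambda>t. f (\<Sum>n<N. of_real (a n) * u t n)) T) \<longlongrightarrow>
    (\<integral>\<omega>. f (\<Sum>n<N. of_real (a n) * X n \<omega>) \<partial>M)) at_top"
proof (rule tendstoI)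
  fix \<epsilon> :: real assume \<epsilon>: "\<epsilon> > 0"
  interpret prob_space M by fact
  note [measurable] = X(1)
  define r where "r = (\<Sum>n<N. \<bar>a n\<bar>)"
  have r: "(\<Sum>n<N. of_real (a n) * w n) \<in> cball 0 r" if "\<And>n. norm (w n) = 1" for w :: "nat \<Rightarrow> complex"
    unfolding r_def by (simp, rule sum_norm_le) (simp add: norm_mult that)
  obtain g where g: "real_polynomial_function g" "\<And>z. z \<in> cball 0 r \<Longrightarrow> \<bar>f z - g z\<bar> < \<epsilon> / 4"
    using Stone_Weierstrass_real_polynomial_function[of "cball 0 r" f "\<epsilon> / 4"] \<epsilon> continuous_on_subset[OF f] by auto
  let ?Z = "\<lambda>w. \<Sum>n<N. of_real (a n) * w n"
  have cg: "continuous_on A g" for A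
    using g(1) continuous_on_polymonial_function real_polynomial_function_eq by blast
  have fm [measurable]: "f \<in> borel_measurable borel" "g \<in> borel_measurable borel"
    using f cg by (auto intro: borel_measurable_continuous_onI)
  have bd: "\<exists>B. \<forall>z\<in>cball 0 r. \<bar>h z\<bar> \<le> B" if "continuous_on UNIV h" for h :: "complex \<Rightarrow> real"
    using compact_imp_bounded[OF compact_continuous_image[OF continuous_on_subset[OF that subset_UNIV, of "cball 0 r"]]]
    by (auto simp: bounded_iff)
  have int: "integrable M (\<lambda>\<omega>. h (?Z (\<lambda>n. X n \<omega>)))"
    if ch: "continuous_on UNIV h" and [measurable]: "h \<in> borel_measurable borel" for h :: "complex \<Rightarrow> real"
  proof -
    obtain B where B: "\<And>z. z \<in> cball 0 r \<Longrightarrow> \<bar>h z\<bar> \<le> B" using bd[OF ch] by metis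
    show ?thesis
      by (rule integrable_const_bound[of _ B]) (use B r X(2) in auto)
  qed
  have E: "\<bar>(\<integral>\<omega>. f (?Z (\<lambda>n. X n \<omega>)) \<partial>M) - (\<integral>\<omega>. g (?Z (\<lambda>n. X n \<omega>)) \<partial>M)\<bar> \<le> \<epsilon> / 4"
  proof -
    have i: "integrable M (\<lambda>\<omega>. f (?Z (\<lambda>n. X n \<omega>)))" "integrable M (\<lambda>\<omega>. g (?Z (\<lambda>n. X n \<omega>)))"
      using int f cg fm by auto
    have "\<bar>(\<integral>\<omega>. f (?Z (\<lambda>n. X n \<omega>)) - g (?Z (\<lambda>n. X n \<omega>)) \<partial>M)\<bar> \<le> (\<integral>\<omega>. \<bar>f (?Z (\<lambda>n. X n \<omega>)) - g (?Z (\<lambda>n. X n \<omega>))\<bar> \<partial>M)"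
      by (rule integral_abs_bound)
    also have "\<dots> \<le> (\<integral>\<omega>. \<epsilon> / 4 \<partial>M)"
    proof (intro integral_mono integrable_abs Bochner_Integration.integrable_diff i)
      fix \<omega> assume "\<omega> \<in> space M"
      thus "\<bar>f (?Z (\<lambda>n. X n \<omega>)) - g (?Z (\<lambda>n. X n \<omega>))\<bar> \<le> \<epsilon> / 4"
        by (intro less_imp_le[OF g(2)] r X(2))
    qed auto
    finally show ?thesis using i by (simp add: prob_space)
  qed
  have cu: "continuous_on UNIV (\<lambda>t. ?Z (u t))" by (intro continuous_intros u)
  have cc: "continuous_on A (\<lambda>t. h (?Z (u t)))" if "continuous_on UNIV h" for h :: "complex \<Rightarrow> real" and A
    by (rule continuous_on_compose2[OF that continuous_on_subset[OF cu]]) auto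
  have "((\<lambda>T. time_mean (\<lambda>t. complex_of_real (g (?Z (u t)))) T) \<longlongrightarrow>
      (\<integral>\<omega>. complex_of_real (g (?Z (\<lambda>n. X n \<omega>))) \<partial>M)) at_top"
    using trig_poly_time_mean[OF assms(1) X u mono trig_poly_real_polynomial_function[OF g(1)]] by blast
  moreover have "time_mean (\<lambda>t. complex_of_real (g (?Z (u t)))) T = of_real (time_mean (\<lambda>t. g (?Z (u t))) T)" for T
  proof -
    have "(\<lambda>t. g (?Z (u t))) integrable_on {0..T}"
      by (intro integrable_continuous_interval cc cg)
    from has_integral_of_real[OF integrable_integral[OF this], where 'b = complex]
    show ?thesis by (simp add: time_mean_def integral_unique scaleR_conv_of_real)
  qed
  ultimately have "((\<lambda>T. time_mean (\<lambda>t. g (?Z (u t))) T) \<longlongrightarrow> (\<integral>\<omega>. g (?Z (\<lambda>n. X n \<omega>)) \<partial>M)) at_top"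
    by (simp add: tendsto_of_real_iff)
  hence "\<forall>\<^sub>F T in at_top. dist (time_mean (\<lambda>t. g (?Z (u t))) T) (\<integral>\<omega>. g (?Z (\<lambda>n. X n \<omega>)) \<partial>M) < \<epsilon> / 4"
    by (rule tendstoD) (use \<epsilon> in auto)
  thus "\<forall>\<^sub>F T in at_top. dist (time_mean (\<lambda>t. f (?Z (u t))) T) (\<integral>\<omega>. f (?Z (\<lambda>n. X n \<omega>)) \<partial>M) < \<epsilon>"
    using eventually_gt_at_top[of 0]
  proof eventually_elim
    case (elim T)
    have "\<bar>time_mean (\<lambda>t. f (?Z (u t))) T - time_mean (\<lambda>t. g (?Z (u t))) T\<bar> \<le> \<epsilon> / 4"
      by (intro time_mean_diff_le cc f cg elim(2) less_imp_le[OF g(2)] r u(2))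
    thus ?case using elim(1) E \<epsilon> unfolding dist_real_def by linarith
  qed
qed

section \<open>Almost sure convergence of orthogonal series\<close>

text \<open>The binary digits of \<open>m\<close> cut \<open>{..<m}\<close> into at most one dyadic interval of each length \<open>2\<^sup>l\<close>.\<close>

lemma norm_initial_sum_le_dyadic:
  fixes y :: "nat \<Rightarrow> 'b :: real_normed_vector"
  assumes m: "m \<le> 2 ^ j"
    and V: "\<And>l i. l \<le> j \<Longrightarrow> i < 2 ^ (j - l) \<Longrightarrow> norm (\<Sum>n\<in>{2^l * i..<2^l * Suc i}. y n) \<le> V l"
  shows "norm (\<Sum>n<m. y n) \<le> (\<Sum>l\<le>j. V l)"
proof -
  have V0: "V l \<ge> 0" if "l \<le> j" for l
    using order_trans[OF norm_ge_zero V[of l 0]] that by simp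
  \<comment> \<open>Here \<open>L\<close> counts the low binary digits removed from
    \<open>m\<close>. The next digit is the parity of \<open>k\<close>: an even \<open>k\<close>
    costs nothing, an odd one costs the interval with index \<open>k - 1\<close>.\<close>
  have "norm (\<Sum>n<m. y n) \<le> (\<Sum>l<L. V l) + norm (\<Sum>n<2^L * (m div 2^L). y n)" if "L \<le> Suc j" for L
    using that
  proof (induction L)
    case (Suc L)
    define k where "k = m div 2 ^ L"
    have k: "m div 2 ^ Suc L = k div 2" by (metis k_def div_mult2_eq mult.commute power_Suc)
    have "norm (\<Sum>n<2^L * k. y n) \<le> V L + norm (\<Sum>n<2^L * (2 * (k div 2)). y n)"
    proof (cases "even k")
      case True
      thus ?thesis using V0[of L] Suc.prems by simp
    next
      case False
      define i where "i = 2 * (k div 2)"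
      have ki: "k = Suc i" using False by (simp add: i_def)
      have "2 ^ L * k \<le> 2 ^ j" 
        using order_trans[OF times_div_less_eq_dividend[of "2 ^ L" m] m] by (simp add: k_def)
      also have "(2::nat) ^ j = 2 ^ L * 2 ^ (j - L)" using Suc.prems by (simp flip: power_add)
      finally have "k \<le> 2 ^ (j - L)" by simp
      hence "i < 2 ^ (j - L)" using ki by linarith
      hence VL: "norm (\<Sum>n\<in>{2^L * i..<2^L * Suc i}. y n) \<le> V L"
        using Suc.prems by (intro V) auto
      have "(\<Sum>n<2^L * Suc i. y n) = (\<Sum>n<2^L * i. y n) + (\<Sum>n\<in>{2^L * i..<2^L * Suc i}. y n)"
        unfolding lessThan_atLeast0 by (rule sum.atLeastLessThan_concat[symmetric]) (rule le0, rule mult_le_mono2, simp)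
      hence "norm (\<Sum>n<2^L * Suc i. y n) \<le> norm (\<Sum>n<2^L * i. y n) + V L"
        using order_trans[OF norm_triangle_ineq add_left_mono[OF VL]] by simp
      hence "norm (\<Sum>n<2^L * k. y n) \<le> norm (\<Sum>n<2^L * i. y n) + V L" unfolding ki[symmetric] .
      thus ?thesis unfolding i_def by linarith
    qed
    moreover have "norm (\<Sum>n<m. y n) \<le> (\<Sum>l<L. V l) + norm (\<Sum>n<2^L * k. y n)"
      unfolding k_def using Suc.prems by (intro Suc.IH) simp
    moreover have "2 ^ Suc L * (m div 2 ^ Suc L) = 2 ^ L * (2 * (k div 2))"
      unfolding k by simp
    ultimately show ?case by (simp only: sum.lessThan_Suc)
  qed simp
  from this[of "Suc j"] have "norm (\<Sum>n<m. y n) \<le> (\<Sum>l<Suc j. V l) + norm (\<Sum>n<2^Suc j * (m div 2^Suc j). y n)"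
    by simp
  moreover have "m div 2 ^ Suc j = 0" using le_less_trans[OF m, of "2 ^ Suc j"] by (intro div_less) simp
  ultimately show ?thesis by (simp only: lessThan_Suc_atMost) simp
qed

text \<open>Summability of \<open>W\<close> makes the partial sums at powers of two converge, and
  \<open>W j\<close> tending to \<open>0\<close> controls every partial sum between two consecutive
  powers.\<close>

lemma summable_if_dyadic_blocks_summable:
  fixes y :: "nat \<Rightarrow> 'b :: banach"
  assumes W: "summable W"
    and block: "\<And>j m. m \<le> 2 ^ j \<Longrightarrow> norm (\<Sum>n<m. y (2 ^ j + n)) \<le> W j"
  shows "summable y"
proof -
  define P where "P = (\<lambda>K. \<Sum>n<K. y n)"
  have P: "norm (P (2 ^ j + m) - P (2 ^ j)) \<le> W j" if "m \<le> 2 ^ j" for j m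
  proof -
    have "P (2 ^ j + m) - P (2 ^ j) = (\<Sum>n<m. y (2 ^ j + n))"
      by (induction m) (auto simp: P_def algebra_simps)
    thus ?thesis using block[OF that] by simp
  qed
  have "summable (\<lambda>j. P (2 ^ Suc j) - P (2 ^ j))"
  proof (rule summable_comparison_test'[OF W])
    show "norm (P (2 ^ Suc j) - P (2 ^ j)) \<le> W j" for j
      using P[of "2 ^ j" j] by (simp add: mult_2)
  qed
  hence "convergent (\<lambda>J. \<Sum>j<J. P (2 ^ Suc j) - P (2 ^ j))" by (simp add: summable_iff_convergent)
  moreover have "(\<Sum>j<J. P (2 ^ Suc j) - P (2 ^ j)) = P (2 ^ J) - P (2 ^ 0)" for J
    by (rule sum_lessThan_telescope)
  ultimately have "convergent (\<lambda>J. P (2 ^ J) - P (2 ^ 0))" by simp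
  then obtain L0 where "(\<lambda>J. P (2 ^ J) - P (2 ^ 0)) \<longlonglongrightarrow> L0" by (auto simp: convergent_def)
  from tendsto_add[OF this tendsto_const[of "P (2 ^ 0)"]]
  have L: "(\<lambda>J. P (2 ^ J)) \<longlonglongrightarrow> L0 + P (2 ^ 0)" by simp
  have "P \<longlonglongrightarrow> L0 + P (2 ^ 0)"
  proof (rule LIMSEQ_I)
    fix r :: real assume "r > 0"
    hence 1: "\<forall>\<^sub>F j in sequentially. norm (P (2 ^ j) - (L0 + P (2 ^ 0))) < r / 2"
      using tendstoD[OF L, of "r / 2"] by (simp add: dist_norm)
    have 2: "\<forall>\<^sub>F j in sequentially. W j < r / 2"
      using order_tendstoD(2)[OF summable_LIMSEQ_zero[OF W], of "r / 2"] \<open>r > 0\<close> by simp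
    obtain J where J: "\<And>j. j \<ge> J \<Longrightarrow> norm (P (2 ^ j) - (L0 + P (2 ^ 0))) < r / 2 \<and> W j < r / 2"
      using eventually_conj[OF 1 2] unfolding eventually_sequentially by blast
    show "\<exists>no. \<forall>K\<ge>no. norm (P K - (L0 + P (2 ^ 0))) < r"
    proof (intro exI allI impI)
      fix K :: nat assume K: "K \<ge> 2 ^ J"
      hence "K \<ge> 1" by (meson one_le_numeral one_le_power order_trans)
      then obtain j where j: "2 ^ j \<le> K" "K < 2 ^ (j + 1)" using ex_power_ivl1[of 2 K] by auto
      have "(2::nat) ^ J < 2 ^ (j + 1)" using K j by linarith
      hence "J \<le> j" by (simp del: power_Suc)
      have "norm (P (2 ^ j + (K - 2 ^ j)) - P (2 ^ j)) \<le> W j" using j by (intro P) auto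
      hence "norm (P K - P (2 ^ j)) < r / 2" using j J[OF \<open>J \<le> j\<close>] by simp
      moreover have "norm (P (2 ^ j) - (L0 + P (2 ^ 0))) < r / 2" using J[OF \<open>J \<le> j\<close>] by simp
      ultimately show "norm (P K - (L0 + P (2 ^ 0))) < r" 
        using norm_diff_triangle_less[of "P K" "P (2 ^ j)" "r / 2" "L0 + P (2 ^ 0)" "r / 2"] by simp
    qed
  qed
  thus ?thesis by (auto simp: summable_iff_convergent convergent_def P_def)
qed

text \<open>Pythagoras: the square expands into a double sum whose off-diagonal expectations vanish.
  The pointwise bounds supply integrability of all products.\<close>

lemma (in prob_space) integral_norm_square_orthogonal_sum:
  fixes Y :: "nat \<Rightarrow> 'a \<Rightarrow> complex"
  assumes Y: "\<And>n. Y n \<in> borel_measurable M" "\<And>n \<omega>. \<omega> \<in> space M \<Longrightarrow> norm (Y n \<omega>) \<le> a n"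
    and orth: "\<And>m n. m \<noteq> n \<Longrightarrow> (\<integral>\<omega>. Y m \<omega> * cnj (Y n \<omega>) \<partial>M) = 0"
    and A: "finite A"
  shows "integrable M (\<lambda>\<omega>. (norm (\<Sum>n\<in>A. Y n \<omega>))\<^sup>2)"
    and "(\<integral>\<omega>. (norm (\<Sum>n\<in>A. Y n \<omega>))\<^sup>2 \<partial>M) \<le> (\<Sum>n\<in>A. (a n)\<^sup>2)"
proof -
  note [measurable] = Y(1)
  have [measurable]: "cnj \<in> borel_measurable borel"
    by (intro borel_measurable_continuous_onI continuous_intros)
  have int: "integrable M (\<lambda>\<omega>. Y m \<omega> * cnj (Y n \<omega>))" for m n
  proof (rule integrable_const_bound[of _ "a m * a n"])
    show "AE \<omega> in M. norm (Y m \<omega> * cnj (Y n \<omega>)) \<le> a m * a n"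
      using Y(2) order_trans[OF norm_ge_zero Y(2)] by (auto simp: norm_mult intro!: mult_mono)
  qed measurable
  have eq: "complex_of_real ((norm (\<Sum>n\<in>A. Y n \<omega>))\<^sup>2) = (\<Sum>m\<in>A. \<Sum>n\<in>A. Y m \<omega> * cnj (Y n \<omega>))" for \<omega>
    unfolding complex_norm_square cnj_sum sum_product ..
  have i: "integrable M (\<lambda>\<omega>. complex_of_real ((norm (\<Sum>n\<in>A. Y n \<omega>))\<^sup>2))"
    unfolding eq by (intro Bochner_Integration.integrable_sum int)
  thus i': "integrable M (\<lambda>\<omega>. (norm (\<Sum>n\<in>A. Y n \<omega>))\<^sup>2)" by (simp only: complex_of_real_integrable_eq)
  have "complex_of_real (\<integral>\<omega>. (norm (\<Sum>n\<in>A. Y n \<omega>))\<^sup>2 \<partial>M) = (\<Sum>m\<in>A. \<Sum>n\<in>A. \<integral>\<omega>. Y m \<omega> * cnj (Y n \<omega>) \<partial>M)"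
    unfolding integral_complex_of_real[symmetric] eq
    by (simp add: Bochner_Integration.integral_sum Bochner_Integration.integrable_sum int)
  also have "\<dots> = (\<Sum>m\<in>A. \<integral>\<omega>. Y m \<omega> * cnj (Y m \<omega>) \<partial>M)"
  proof (intro sum.cong refl)
    fix m assume "m \<in> A"
    have "(\<Sum>n\<in>A. \<integral>\<omega>. Y m \<omega> * cnj (Y n \<omega>) \<partial>M) = (\<Sum>n\<in>A. if n = m then \<integral>\<omega>. Y m \<omega> * cnj (Y m \<omega>) \<partial>M else 0)"
      by (intro sum.cong refl) (use orth in auto)
    thus "(\<Sum>n\<in>A. \<integral>\<omega>. Y m \<omega> * cnj (Y n \<omega>) \<partial>M) = (\<integral>\<omega>. Y m \<omega> * cnj (Y m \<omega>) \<partial>M)"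
      using A \<open>m \<in> A\<close> by simp
  qed
  also have "\<dots> = complex_of_real (\<Sum>m\<in>A. \<integral>\<omega>. (norm (Y m \<omega>))\<^sup>2 \<partial>M)"
  proof -
    have sq: "Y m \<omega> * cnj (Y m \<omega>) = complex_of_real ((norm (Y m \<omega>))\<^sup>2)" for m \<omega>
      by (rule complex_norm_square[symmetric])
    show ?thesis unfolding sq integral_complex_of_real of_real_sum ..
  qed
  finally have "(\<integral>\<omega>. (norm (\<Sum>n\<in>A. Y n \<omega>))\<^sup>2 \<partial>M) = (\<Sum>m\<in>A. \<integral>\<omega>. (norm (Y m \<omega>))\<^sup>2 \<partial>M)"
    by (simp only: of_real_eq_iff)
  also have "\<dots> \<le> (\<Sum>n\<in>A. (a n)\<^sup>2)"
  proof (intro sum_mono)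
    fix m
    have le: "(norm (Y m \<omega>))\<^sup>2 \<le> (a m)\<^sup>2" if "\<omega> \<in> space M" for \<omega>
      using Y(2)[OF that] by (intro power_mono) auto
    have "integrable M (\<lambda>\<omega>. (norm (Y m \<omega>))\<^sup>2)"
      by (rule integrable_const_bound[of _ "(a m)\<^sup>2"]) (use le in auto)
    hence "(\<integral>\<omega>. (norm (Y m \<omega>))\<^sup>2 \<partial>M) \<le> (\<integral>\<omega>. (a m)\<^sup>2 \<partial>M)"
      by (intro integral_mono le) auto
    thus "(\<integral>\<omega>. (norm (Y m \<omega>))\<^sup>2 \<partial>M) \<le> (a m)\<^sup>2" by (simp add: prob_space)
  qed
  finally show "(\<integral>\<omega>. (norm (\<Sum>n\<in>A. Y n \<omega>))\<^sup>2 \<partial>M) \<le> (\<Sum>n\<in>A. (a n)\<^sup>2)" .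
qed

text \<open>By monotone convergence the series of nonnegative functions has finite integral, hence
  is finite almost everywhere.\<close>

lemma AE_summable_if_integrals_summable:
  fixes W :: "nat \<Rightarrow> 'a \<Rightarrow> real"
  assumes W: "\<And>j. integrable M (W j)" "\<And>j \<omega>. W j \<omega> \<ge> 0"
    and c: "\<And>j. (\<integral>\<omega>. W j \<omega> \<partial>M) \<le> c j" "summable c"
  shows "AE \<omega> in M. summable (\<lambda>j. W j \<omega>)"
proof -
  note [measurable] = borel_measurable_integrable[OF W(1)]
  have c0: "c j \<ge> 0" for j 
    using order_trans[OF Bochner_Integration.integral_nonneg c(1)[of j]] W(2) by blast
  have "(\<integral>\<^sup>+\<omega>. (\<Sum>j. ennreal (W j \<omega>)) \<partial>M) = (\<Sum>j. \<integral>\<^sup>+\<omega>. ennreal (W j \<omega>) \<partial>M)"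
    by (rule nn_integral_suminf) measurable
  also have "\<dots> \<le> (\<Sum>j. ennreal (c j))"
    using W c(1) by (intro suminf_le) (auto simp: nn_integral_eq_integral intro!: ennreal_leI)
  also have "\<dots> < \<infinity>" using c c0 by (simp add: suminf_ennreal2 less_top)
  finally have "AE \<omega> in M. (\<Sum>j. ennreal (W j \<omega>)) \<noteq> \<infinity>"
    by (intro nn_integral_PInf_AE) (auto simp: less_top)
  thus ?thesis by eventually_elim (rule summable_suminf_not_top, use W(2) in auto)
qed

text \<open>In the block from \<open>2^j\<close> to \<open>2^(j + 1)\<close> every term has norm at
  most \<open>2^(-j * \<sigma>)\<close>. At each level \<open>l\<close> the squared interval sums
  therefore have total expectation at most \<open>2^j * 2^(-2 * j * \<sigma>) = x^(2 * j)\<close>.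
  The \<open>j + 1\<close> levels together contribute at most \<open>(j + 1) * x^j\<close>, which is
  summable because \<open>\<sigma> > 1 / 2\<close> gives \<open>x < 1\<close>.\<close>

lemma (in prob_space) AE_summable_orthogonal:
  fixes Y :: "nat \<Rightarrow> 'a \<Rightarrow> complex"
  assumes Y: "\<And>n. Y n \<in> borel_measurable M" "\<And>n \<omega>. n \<ge> 1 \<Longrightarrow> \<omega> \<in> space M \<Longrightarrow> norm (Y n \<omega>) \<le> real n powr (- \<sigma>)"
    and orth: "\<And>m n. m \<noteq> n \<Longrightarrow> (\<integral>\<omega>. Y m \<omega> * cnj (Y n \<omega>) \<partial>M) = 0"
    and \<sigma>: "\<sigma> > 1 / 2"
  shows "AE \<omega> in M. summable (\<lambda>n. Y n \<omega>)"
proof -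
  define x where "x = 2 powr (1 / 2 - \<sigma>)"
  have x: "0 < x" "x < 1" using \<sigma> by (auto simp: x_def powr_less_one)
  define D where "D = (\<lambda>j l i \<omega>. norm (\<Sum>n\<in>{2^l * i..<2^l * Suc i}. Y (2^j + n) \<omega>))"
  \<comment> \<open>Summing over all intervals of a level bounds whichever of them occurs in the
    dyadic decomposition, so \<open>W j\<close> dominates every initial sum of block
    \<open>j\<close> at once.\<close>
  define W where "W = (\<lambda>j \<omega>. \<Sum>l\<le>j. x ^ j / 2 + (\<Sum>i<(2::nat)^(j - l). (D j l i \<omega>)\<^sup>2) / (2 * x ^ j))"
  define c where "c = (\<lambda>j. real (Suc j) * x ^ j)"
  have orth': "(\<integral>\<omega>. Y (2^j + m) \<omega> * cnj (Y (2^j + n) \<omega>) \<partial>M) = 0" if "m \<noteq> n" for j m n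
    using that by (intro orth) auto
  have Y': "norm (Y (2^j + n) \<omega>) \<le> (2 ^ j) powr (- \<sigma>)" if "\<omega> \<in> space M" for j n \<omega>
  proof -
    have "norm (Y (2^j + n) \<omega>) \<le> real (2^j + n) powr (- \<sigma>)" using that by (intro Y(2)) (auto intro: trans_le_add1)
    also have "\<dots> \<le> (2 ^ j) powr (- \<sigma>)" using \<sigma> by (intro powr_mono2') auto
    finally show ?thesis .
  qed
  have D: "integrable M (\<lambda>\<omega>. (D j l i \<omega>)\<^sup>2)" "(\<integral>\<omega>. (D j l i \<omega>)\<^sup>2 \<partial>M) \<le> 2 ^ l * ((2 ^ j) powr (- \<sigma>))\<^sup>2" for j l i
    unfolding D_def 
    using integral_norm_square_orthogonal_sum[of "\<lambda>n. Y (2^j + n)", OF Y(1) Y' orth', of "{2^l * i..<2^l * Suc i}"]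
    by auto
  have W_int: "integrable M (W j)" for j
    unfolding W_def by (intro Bochner_Integration.integrable_sum Bochner_Integration.integrable_add
        Bochner_Integration.integrable_divide D integrable_const)
  have W0: "W j \<omega> \<ge> 0" for j \<omega>
    unfolding W_def using x by (intro sum_nonneg add_nonneg_nonneg divide_nonneg_nonneg) auto
  have x2: "2 ^ j * ((2 ^ j) powr (- \<sigma>))\<^sup>2 = (x ^ j)\<^sup>2" for j
  proof -
    have "x ^ j = 2 powr (real j * (1 / 2 - \<sigma>))" by (simp add: x_def powr_power)
    also have "\<dots> = (2 powr real j) powr (1 / 2 - \<sigma>)" by (simp only: powr_powr)
    also have "2 powr real j = 2 ^ j" by (simp add: powr_realpow)
    finally have "x ^ j = (2 ^ j) powr (1 / 2 - \<sigma>)" .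
    hence "(x ^ j)\<^sup>2 = (2 ^ j) powr (1 + (- 2 * \<sigma>))"
      by (simp add: power2_eq_square flip: powr_add)
    also have "\<dots> = (2 ^ j) powr 1 * (2 ^ j) powr (- 2 * \<sigma>)" by (rule powr_add)
    also have "(2 ^ j) powr (- 2 * \<sigma>) = ((2 ^ j) powr (- \<sigma>))\<^sup>2"
      by (simp add: power2_eq_square flip: powr_add)
    finally show ?thesis by simp
  qed
  have W_le: "(\<integral>\<omega>. W j \<omega> \<partial>M) \<le> c j" for j
  proof -
    have "(\<integral>\<omega>. W j \<omega> \<partial>M) = (\<Sum>l\<le>j. x ^ j / 2 + (\<Sum>i<(2::nat)^(j - l). \<integral>\<omega>. (D j l i \<omega>)\<^sup>2 \<partial>M) / (2 * x ^ j))"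
      unfolding W_def using D(1) by (subst Bochner_Integration.integral_sum) (auto simp: prob_space)
    also have "\<dots> \<le> (\<Sum>l\<le>j. x ^ j / 2 + (\<Sum>i<(2::nat)^(j - l). 2 ^ l * ((2 ^ j) powr (- \<sigma>))\<^sup>2) / (2 * x ^ j))"
      using x by (intro sum_mono add_left_mono divide_right_mono D) auto
    also have "\<dots> = (\<Sum>l\<le>j. x ^ j)"
    proof (intro sum.cong refl)
      fix l assume "l \<in> {..j}"
      hence "(2::real) ^ (j - l) * 2 ^ l = 2 ^ j" by (simp flip: power_add)
      hence "2 ^ (j - l) * (2 ^ l * q) = 2 ^ j * q" for q :: real by (simp only: mult.assoc[symmetric])
      moreover have "(\<Sum>i<(2::nat)^(j - l). 2 ^ l * ((2 ^ j) powr (- \<sigma>))\<^sup>2) =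
          2 ^ (j - l) * (2 ^ l * ((2 ^ j) powr (- \<sigma>))\<^sup>2)" by simp
      ultimately have "(\<Sum>i<(2::nat)^(j - l). 2 ^ l * ((2 ^ j) powr (- \<sigma>))\<^sup>2) = 2 ^ j * ((2 ^ j) powr (- \<sigma>))\<^sup>2"
        by (simp only:)
      note eq = this[unfolded x2]
      show "x ^ j / 2 + (\<Sum>i<(2::nat)^(j - l). 2 ^ l * ((2 ^ j) powr (- \<sigma>))\<^sup>2) / (2 * x ^ j) = x ^ j"
        unfolding eq using x by (simp add: power2_eq_square)
    qed
    finally show ?thesis by (simp add: c_def)
  qed
  have "summable c"
    using geometric_deriv_sums[of x] x by (auto simp: c_def sums_iff)
  from AE_summable_if_integrals_summable[OF W_int W0 W_le this]
  show ?thesis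
  proof eventually_elim
    case (elim \<omega>)
    show ?case
    proof (rule summable_if_dyadic_blocks_summable[OF elim])
      fix j m :: nat assume m: "m \<le> 2 ^ j"
      show "norm (\<Sum>n<m. Y (2 ^ j + n) \<omega>) \<le> W j \<omega>"
        unfolding W_def
      proof (rule norm_initial_sum_le_dyadic[OF m])
        fix l i assume li: "l \<le> j" "i < (2::nat) ^ (j - l)"
        define d where "d = D j l i \<omega>"
        \<comment> \<open>AM-GM replaces \<open>d\<close> by its square, whose expectation is known, at the scale \<open>x\<^sup>j\<close>.\<close>
        have "0 \<le> (d - x ^ j)\<^sup>2" by simp
        hence "d \<le> x ^ j / 2 + d\<^sup>2 / (2 * x ^ j)"
          using x by (simp add: power2_eq_square field_simps)
        also have "d\<^sup>2 \<le> (\<Sum>i<(2::nat)^(j - l). (D j l i \<omega>)\<^sup>2)"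
          unfolding d_def using li by (intro member_le_sum) auto
        finally show "norm (\<Sum>n\<in>{2^l * i..<2^l * Suc i}. Y (2 ^ j + n) \<omega>) \<le>
            x ^ j / 2 + (\<Sum>i<(2::nat)^(j - l). (D j l i \<omega>)\<^sup>2) / (2 * x ^ j)"
          using x by (simp add: d_def D_def divide_right_mono)
      qed
    qed
  qed
qed

section \<open>Weak convergence\<close>

text \<open>A bounded continuous \<open>f\<close> need not be uniformly continuous on the plane, so
  the exceptional cases are paid for by squares. Where \<open>z - w\<close> or \<open>w\<close> is
  large, the trivial bound \<open>2 * B\<close> is at most the corresponding quadratic term;
  elsewhere uniform continuity on a disc applies. In the application \<open>C\<close> bounds the
  mean square of \<open>w\<close>.\<close>

lemma bounded_continuous_quadratic_modulus:
  fixes f :: "complex \<Rightarrow> real"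
  assumes f: "continuous_on UNIV f" and B: "\<And>z. \<bar>f z\<bar> \<le> B" and e: "e > 0" and C: "C > 0"
  obtains K1 K2 where "K1 \<ge> 0" "K2 \<ge> 0" "K2 * C \<le> e"
    "\<And>z w. \<bar>f z - f w\<bar> \<le> e + K1 * (norm (z - w))\<^sup>2 + K2 * (norm w)\<^sup>2"
proof -
  have B0: "B \<ge> 0" using B[of 0] by linarith
  \<comment> \<open>Chosen so that \<open>K2 = 2 * B / R^2\<close> satisfies
    \<open>K2 * C <= e\<close>; the added \<open>1\<close> keeps \<open>R\<close> positive when
    \<open>B = 0\<close>.\<close>
  define R where "R = sqrt (2 * B * C / e + 1)"
  have R2: "R\<^sup>2 = 2 * B * C / e + 1" unfolding R_def using B0 C e by simp
  have R0: "R > 0" unfolding R_def using B0 C e by (intro real_sqrt_gt_zero add_nonneg_pos) auto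
  have "uniformly_continuous_on (cball 0 (R + 1)) f"
    by (intro compact_uniformly_continuous continuous_on_subset[OF f]) auto
  then obtain d where d: "d > 0" "\<And>z w. z \<in> cball 0 (R + 1) \<Longrightarrow> w \<in> cball 0 (R + 1) \<Longrightarrow> dist z w < d \<Longrightarrow> dist (f z) (f w) < e"
    using e unfolding uniformly_continuous_on_def by metis
  \<comment> \<open>The cap at \<open>1\<close> keeps \<open>z\<close> in the disc of radius
    \<open>R + 1\<close> when \<open>norm w < R\<close>.\<close>
  define \<delta> where "\<delta> = min d 1"
  have \<delta>: "\<delta> > 0" "\<delta> \<le> d" "\<delta> \<le> 1" using d(1) by (auto simp: \<delta>_def)
  show ?thesis
  proof (rule that[of "2 * B / \<delta>\<^sup>2" "2 * B / R\<^sup>2"])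
    have "2 * B * C = e * (2 * B * C / e)" using e by simp
    also have "\<dots> \<le> e * R\<^sup>2" using R2 e by (intro mult_left_mono) auto
    finally show "2 * B / R\<^sup>2 * C \<le> e" using R0 by (simp add: field_simps)
    fix z w :: complex
    have nn: "2 * B / \<delta>\<^sup>2 * (norm (z - w))\<^sup>2 \<ge> 0" "2 * B / R\<^sup>2 * (norm w)\<^sup>2 \<ge> 0" using B0 by auto
    have tot: "\<bar>f z - f w\<bar> \<le> 2 * B" using B[of z] B[of w] by linarith
    have big: "2 * B \<le> 2 * B / r\<^sup>2 * x\<^sup>2" if "r > 0" "x \<ge> r" for r x :: real
    proof -
      have "2 * B * r\<^sup>2 \<le> 2 * B * x\<^sup>2" using that B0 by (intro mult_left_mono power_mono) auto
      thus ?thesis using that by (simp add: field_simps)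
    qed
    consider "norm (z - w) \<ge> \<delta>" | "norm w \<ge> R" | "norm (z - w) < \<delta>" "norm w < R" by linarith
    thus "\<bar>f z - f w\<bar> \<le> e + 2 * B / \<delta>\<^sup>2 * (norm (z - w))\<^sup>2 + 2 * B / R\<^sup>2 * (norm w)\<^sup>2"
    proof cases
      case 1
      thus ?thesis using big[OF \<delta>(1) 1] tot nn e by linarith
    next
      case 2
      thus ?thesis using big[OF R0 2] tot nn e by linarith
    next
      case 3
      have "norm z \<le> norm (z - w) + norm w" using norm_triangle_ineq[of "z - w" w] by simp
      hence "dist (f z) (f w) < e" using 3 \<delta> by (intro d(2)) (auto simp: dist_norm)
      thus ?thesis using nn by (simp add: dist_real_def)
    qed
  qed (use B0 in auto)
qed

text \<open>On \<open>{0..1}\<close>, where the mean square estimate says nothing, only boundedness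
  is used; the resulting \<open>2 * B\<close> disappears after division by a large
  \<open>T\<close>.\<close>

lemma time_mean_diff_le_integral:
  fixes g h q :: "real \<Rightarrow> real"
  assumes T: "T \<ge> 1" and g: "g integrable_on {0..T}" and h: "h integrable_on {0..T}"
    and B: "\<And>t. \<bar>g t\<bar> \<le> B" "\<And>t. \<bar>h t\<bar> \<le> B"
    and q: "q integrable_on {1..T}" "\<And>t. t \<in> {1..T} \<Longrightarrow> \<bar>g t - h t\<bar> \<le> q t"
  shows "\<bar>time_mean g T - time_mean h T\<bar> \<le> (2 * B + integral {1..T} q) / T"
proof -
  have gh: "(\<lambda>t. g t - h t) integrable_on {0..T}" using g h by (rule integrable_diff)
  have gh': "(\<lambda>t. g t - h t) integrable_on {0..1}" "(\<lambda>t. g t - h t) integrable_on {1..T}"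
    using T by (auto intro: integrable_on_subinterval[OF gh])
  have "norm (integral {0..1} (\<lambda>t. g t - h t)) \<le> integral {0..1} (\<lambda>t::real. 2 * B)"
  proof (rule integral_norm_bound_integral[OF gh'(1)])
    show "norm (g t - h t) \<le> 2 * B" for t using B(1)[of t] B(2)[of t] by simp
  qed auto
  moreover have "norm (integral {1..T} (\<lambda>t. g t - h t)) \<le> integral {1..T} q"
    by (rule integral_norm_bound_integral[OF gh'(2) q(1)]) (use q(2) in auto)
  moreover have "integral {0..T} (\<lambda>t. g t - h t) = integral {0..1} (\<lambda>t. g t - h t) + integral {1..T} (\<lambda>t. g t - h t)"
    using T by (intro Henstock_Kurzweil_Integration.integral_combine[symmetric] gh) auto
  ultimately have "\<bar>integral {0..T} (\<lambda>t. g t - h t)\<bar> \<le> 2 * B + integral {1..T} q" by simp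
  hence "\<bar>integral {0..T} (\<lambda>t. g t - h t)\<bar> / T \<le> (2 * B + integral {1..T} q) / T"
    using T by (intro divide_right_mono) auto
  moreover have "time_mean g T - time_mean h T = integral {0..T} (\<lambda>t. g t - h t) / T"
    using g h by (simp add: time_mean_def integral_diff diff_divide_distrib)
  ultimately show ?thesis using T by simp
qed

text \<open>Integrability comes from boundedness and measurability, not from continuity: for
  \<open>\<sigma> = 1\<close> the path passes through the pole at \<open>t = 0\<close>.\<close>

lemma integral_zeta_value_measure:
  fixes f :: "complex \<Rightarrow> real"
  assumes a: "\<alpha> > 0" and T: "T > 0" and f: "f \<in> borel_measurable borel" and B: "\<And>z. \<bar>f z\<bar> \<le> B"
  shows "(\<lambda>t. f (hurwitz_zeta \<alpha> (Complex \<sigma> t))) integrable_on {0..T}"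
    and "(\<integral>z. f z \<partial>zeta_value_measure \<sigma> \<alpha> T) = time_mean (\<lambda>t. f (hurwitz_zeta \<alpha> (Complex \<sigma> t))) T"
proof -
  note [measurable] = measurable_hurwitz_zeta_vertical[OF a, of \<sigma>] f
  let ?h = "\<lambda>t. f (hurwitz_zeta \<alpha> (Complex \<sigma> t))"
  have I: "set_integrable lborel {0..T} ?h"
    unfolding set_integrable_def
    by (rule integrableI_bounded_set_indicator[of _ _ _ B]) (use B T in auto)
  show "?h integrable_on {0..T}" by (rule set_borel_integral_eq_integral[OF I])
  have "uniform_measure lborel {0..T} = density lborel (\<lambda>t. ennreal (indicator {0..T} t / T))"
    unfolding uniform_measure_def using T
    by (intro density_cong) (auto split: split_indicator simp: divide_ennreal[symmetric])
  hence "(\<integral>z. f z \<partial>zeta_value_measure \<sigma> \<alpha> T) = (\<integral>t. ?h t \<partial>density lborel (\<lambda>t. ennreal (indicator {0..T} t / T)))"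
    unfolding zeta_value_measure_def by (subst integral_distr) (auto simp flip: \<open>_ = density _ _\<close>)
  also have "\<dots> = (\<integral>t. (indicator {0..T} t / T) *\<^sub>R ?h t \<partial>lborel)"
    using T by (subst integral_density) auto
  also have "\<dots> = (\<integral>t. (1 / T) * (indicator {0..T} t *\<^sub>R ?h t) \<partial>lborel)" by simp
  also have "\<dots> = (1 / T) * (LINT t:{0..T}|lborel. ?h t)"
    unfolding set_lebesgue_integral_def by (rule integral_mult_right_zero)
  also have "(LINT t:{0..T}|lborel. ?h t) = integral {0..T} ?h"
    by (rule set_borel_integral_eq_integral[OF I])
  finally show "(\<integral>z. f z \<partial>zeta_value_measure \<sigma> \<alpha> T) = time_mean ?h T" by (simp add: time_mean_def)
qed

lemma prod_cis: "(\<Prod>n\<in>A. cis (f n)) = cis (\<Sum>n\<in>A. f n)"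
  by (induction A rule: infinite_finite_induct) (auto simp: cis_mult)

text \<open>The product is a single oscillation whose frequency is minus the logarithm of the
  product of the \<open>(n + a) powi e n\<close>. It is constant exactly when that product is
  \<open>1\<close>, which is the case distinction of the moment condition.\<close>

lemma time_mean_prod_cis_ln:
  assumes a: "a > 0"
  shows "((\<lambda>T. time_mean (\<lambda>t. \<Prod>n<N. cis (- t * ln (real n + a)) powi e n) T) \<longlongrightarrow>
    (if (\<Prod>n<N. (real n + a) powi e n) = 1 then 1 else 0)) at_top"
proof -
  define L where "L = (\<Sum>n<N. of_int (e n) * ln (real n + a))"
  have "(\<Prod>n<N. cis (- t * ln (real n + a)) powi e n) = cis (t * - L)" for t
    by (simp add: cis_power_int prod_cis L_def sum_distrib_left mult_ac flip: sum_negf)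
  moreover have "(\<Prod>n<N. (real n + a) powi e n) = exp L"
    unfolding L_def exp_sum[OF finite_lessThan]
  proof (intro prod.cong refl)
    fix n
    have "(real n + a) powi e n = (real n + a) powr of_int (e n)"
      using a by (simp add: powr_real_of_int')
    thus "(real n + a) powi e n = exp (of_int (e n) * ln (real n + a))"
      using a by (simp add: powr_def)
  qed
  ultimately show ?thesis using time_mean_cis[of "- L"] by simp
qed

theorem theorem1p2:
  fixes \<alpha> \<sigma> :: real
    and M :: "'a measure"
    and X :: "nat \<Rightarrow> 'a \<Rightarrow> complex"
  assumes "algebraic \<alpha>" and "0 < \<alpha>" and "\<alpha> \<le> 1"
    and "prob_space M"
    and "\<And>n. X n \<in> borel_measurable M"
    and "\<And>n \<omega>. \<omega> \<in> space M \<Longrightarrow> X n \<omega> \<in> sphere 0 1"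
    and "\<And>(k :: nat) (n :: nat \<Rightarrow> nat) (e :: nat \<Rightarrow> int).
           (\<integral>\<omega>. (\<Prod>i<k. X (n i) \<omega> powi e i) \<partial>M) =
             (if (\<Prod>i<k. (real (n i) + \<alpha>) powi e i) = 1 then 1 else 0)"
    and "\<sigma> > 1 / 2"
  shows "converges_weakly (zeta_value_measure \<sigma> \<alpha>)
           (distr M borel (random_hurwitz_zeta \<sigma> \<alpha> X)) at_top"
proof -
  note \<alpha> = \<open>0 < \<alpha>\<close> and \<sigma> = \<open>\<sigma> > 1 / 2\<close> and moments = assms(7)
  interpret prob_space M by fact
  note [measurable] = assms(5)
  have X: "norm (X n \<omega>) = 1" if "\<omega> \<in> space M" for n \<omega> using assms(6)[OF that, of n] by simp
  define a where "a = (\<lambda>n. (real n + \<alpha>) powr (- \<sigma>))"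
  define Y where "Y = (\<lambda>n \<omega>. X n \<omega> * of_real (a n))"
  define u where "u = (\<lambda>t n. cis (- t * ln (real n + \<alpha>)))"
  define Z where "Z = (\<lambda>N \<omega>. \<Sum>n<N. of_real (a n) * X n \<omega>)"
  define \<zeta> where "\<zeta> = (\<lambda>t. hurwitz_zeta \<alpha> (Complex \<sigma> t))"
  define S where "S = (\<lambda>N t. hz_sum N \<alpha> \<sigma> t)"
  have S_u: "S N t = (\<Sum>n<N. of_real (a n) * u t n)" for N t
    unfolding S_def u_def a_def by (rule hz_sum_conv_cis[OF \<alpha>])
  have S_cont: "continuous_on A (S N)" for A N unfolding S_def by (intro continuous_intros \<alpha>)
  have Z_Y: "Z N \<omega> = (\<Sum>n<N. Y n \<omega>)" for N \<omega> by (simp add: Z_def Y_def mult.commute)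
  have Y_meas [measurable]: "Y n \<in> borel_measurable M" for n unfolding Y_def by measurable
  have Z_meas [measurable]: "Z N \<in> borel_measurable M" for N unfolding Z_def by measurable
  have Y_norm: "norm (Y n \<omega>) = a n" if "\<omega> \<in> space M" for n \<omega>
    using X[OF that] by (simp add: Y_def norm_mult a_def)
  \<comment> \<open>The moment condition with two factors and exponents \<open>1\<close> and
    \<open>- 1\<close>: conjugation is inversion on the unit circle, and \<open>m + \<alpha>\<close>
    differs from \<open>n + \<alpha>\<close>.\<close>
  have orth: "(\<integral>\<omega>. Y m \<omega> * cnj (Y n \<omega>) \<partial>M) = 0" if "m \<noteq> n" for m n
  proof -
    have "(\<integral>\<omega>. Y m \<omega> * cnj (Y n \<omega>) \<partial>M) =
        (\<integral>\<omega>. of_real (a m * a n) * (\<Prod>i<(2::nat). X (if i = 0 then m else n) \<omega> powi (if i = 0 then 1 else - 1)) \<partial>M)"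
    proof (intro Bochner_Integration.integral_cong refl)
      fix \<omega> assume "\<omega> \<in> space M"
      hence "cnj (X n \<omega>) = X n \<omega> powi (-1)"
        using X[of \<omega> n] complex_div_cnj[of 1 "X n \<omega>"] by (simp add: power_int_minus divide_inverse)
      thus "Y m \<omega> * cnj (Y n \<omega>) =
          of_real (a m * a n) * (\<Prod>i<(2::nat). X (if i = 0 then m else n) \<omega> powi (if i = 0 then 1 else - 1))"
        by (simp add: Y_def numeral_2_eq_2 mult_ac)
    qed
    also have "\<dots> = of_real (a m * a n) * (\<integral>\<omega>. (\<Prod>i<(2::nat). X (if i = 0 then m else n) \<omega> powi (if i = 0 then 1 else - 1)) \<partial>M)"
      by (rule integral_mult_right_zero)
    also have "(\<Prod>i<(2::nat). (real (if i = 0 then m else n) + \<alpha>) powi (if i = (0::nat) then 1 else - 1)) \<noteq> 1"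
      using that \<alpha> by (auto simp: numeral_2_eq_2 power_int_minus field_simps)
    hence "(\<integral>\<omega>. (\<Prod>i<(2::nat). X (if i = 0 then m else n) \<omega> powi (if i = (0::nat) then 1 else - 1)) \<partial>M) = 0"
      by (subst moments) auto
    finally show ?thesis by simp
  qed
  have AE_lim: "AE \<omega> in M. (\<lambda>N. Z N \<omega>) \<longlonglongrightarrow> random_hurwitz_zeta \<sigma> \<alpha> X \<omega>"
  proof -
    have "AE \<omega> in M. summable (\<lambda>n. Y n \<omega>)"
    proof (rule AE_summable_orthogonal[OF Y_meas _ orth \<sigma>])
      fix n \<omega> assume "(n::nat) \<ge> 1" "\<omega> \<in> space M"
      thus "norm (Y n \<omega>) \<le> real n powr (- \<sigma>)"
        using \<alpha> \<sigma> by (simp add: Y_norm a_def powr_mono2')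
    qed
    thus ?thesis
    proof eventually_elim
      case (elim \<omega>)
      from summable_LIMSEQ[OF this] show ?case
        unfolding Z_Y by (simp add: random_hurwitz_zeta_def Y_def a_def)
    qed
  qed
  have rv [measurable]: "random_hurwitz_zeta \<sigma> \<alpha> X \<in> borel_measurable M"
    by (rule measurable_random_hurwitz_zeta) measurable

  \<comment> \<open>Second moments and limiting means of the partial sums\<close>
  define C where "C = (\<Sum>n. (a n)\<^sup>2) + 1"
  have a_sum: "summable (\<lambda>n. (a n)\<^sup>2)"
    using summable_shifted_powr[of \<alpha> "2 * \<sigma>"] \<alpha> \<sigma> by (simp add: a_def power2_eq_square flip: powr_add)
  have C_pos: "C > 0" unfolding C_def by (intro add_nonneg_pos suminf_nonneg a_sum) auto
  \<comment> \<open>The \<open>+ 1\<close> in \<open>C\<close> makes this strict, so that the same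
    bound holds for the time mean of the squared norm of \<open>S N\<close> once \<open>T\<close> is
    large.\<close>
  have Z_sq: "(\<integral>\<omega>. (norm (Z N \<omega>))\<^sup>2 \<partial>M) < C" for N
  proof -
    have "(\<integral>\<omega>. (norm (Z N \<omega>))\<^sup>2 \<partial>M) \<le> (\<Sum>n<N. (a n)\<^sup>2)"
      unfolding Z_Y by (rule integral_norm_square_orthogonal_sum(2)[OF Y_meas _ orth]) (auto simp: Y_norm)
    also have "\<dots> \<le> (\<Sum>n. (a n)\<^sup>2)" by (intro sum_le_suminf a_sum) auto
    finally show ?thesis by (simp add: C_def)
  qed
  have mean_S: "((\<lambda>T. time_mean (\<lambda>t. h (S N t)) T) \<longlongrightarrow> (\<integral>\<omega>. h (Z N \<omega>) \<partial>M)) at_top"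
    if h: "continuous_on UNIV h" for h :: "complex \<Rightarrow> real" and N
    unfolding S_u Z_def
  proof (rule continuous_time_mean[OF assms(4,5) X _ _ _ h])
    show "continuous_on UNIV (\<lambda>t. u t n)" for n unfolding u_def by (intro continuous_intros)
    show "norm (u t n) = 1" for t n by (simp add: u_def)
    show "((\<lambda>T. time_mean (\<lambda>t. \<Prod>n<N. u t n powi e n) T) \<longlongrightarrow> (\<integral>\<omega>. (\<Prod>n<N. X n \<omega> powi e n) \<partial>M)) at_top" for e
      using time_mean_prod_cis_ln[OF \<alpha>, where N = N and e = e] moments[where k = N and n = "\<lambda>i. i" and e = e] by (simp only: u_def)
  qed

  \<comment> \<open>Passage from the partial sums to the zeta-function\<close>
  show ?thesis
    unfolding converges_weakly_def
  proof (intro allI impI)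
    fix f :: "complex \<Rightarrow> real"
    assume "continuous_on UNIV f \<and> bounded (range f)"
    hence f: "continuous_on UNIV f" and "bounded (range f)" by auto
    then obtain B where B: "\<bar>f z\<bar> \<le> B" for z by (auto simp: bounded_iff)
    have fm [measurable]: "f \<in> borel_measurable borel" by (rule borel_measurable_continuous_onI[OF f])
    have lim_E: "(\<lambda>N. \<integral>\<omega>. f (Z N \<omega>) \<partial>M) \<longlonglongrightarrow> (\<integral>\<omega>. f (random_hurwitz_zeta \<sigma> \<alpha> X \<omega>) \<partial>M)"
    proof (rule integral_dominated_convergence[where w = "\<lambda>_. B"])
      show "AE \<omega> in M. (\<lambda>N. f (Z N \<omega>)) \<longlonglongrightarrow> f (random_hurwitz_zeta \<sigma> \<alpha> X \<omega>)"
        using AE_lim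
      proof eventually_elim
        case (elim \<omega>)
        show ?case by (rule continuous_on_tendsto_compose[OF f elim]) auto
      qed
    qed (use B in auto)
    have "((\<lambda>T. time_mean (\<lambda>t. f (\<zeta> t)) T) \<longlongrightarrow> (\<integral>\<omega>. f (random_hurwitz_zeta \<sigma> \<alpha> X \<omega>) \<partial>M)) at_top"
    proof (rule tendstoI)
      fix \<epsilon> :: real assume \<epsilon>: "\<epsilon> > 0"
      \<comment> \<open>Six errors of size \<open>e\<close> are collected: three from the integral
        of \<open>?q\<close>, one from \<open>2 * B / T\<close>, and one from each of the limits in
        \<open>T\<close> and in \<open>N\<close>.\<close>
      define e where "e = \<epsilon> / 8"
      have e: "e > 0" using \<epsilon> by (simp add: e_def)
      \<comment> \<open>These constants precede the choice of \<open>N\<close>, which is possible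
        because \<open>C\<close> bounds the second moments of all \<open>Z N\<close>
        simultaneously.\<close>
      obtain K1 K2 where K: "K1 \<ge> 0" "K2 \<ge> 0" "K2 * C \<le> e"
        and mod: "\<And>z w. \<bar>f z - f w\<bar> \<le> e + K1 * (norm (z - w))\<^sup>2 + K2 * (norm w)\<^sup>2"
        using bounded_continuous_quadratic_modulus[OF f B e C_pos] by metis
      \<comment> \<open>The accuracy compensates the factor \<open>K1\<close>; the added
        \<open>1\<close> avoids division by zero when \<open>K1 = 0\<close>.\<close>
      have "e / (K1 + 1) > 0" using e K by simp
      from hurwitz_zeta_mean_square_approx[OF \<sigma> \<alpha> this]
      have "\<forall>\<^sub>F N in sequentially. \<forall>\<^sub>F T in at_top.
          integral {1..T} (\<lambda>t. (norm (\<zeta> t - S N t))\<^sup>2) \<le> e / (K1 + 1) * T" by (simp add: \<zeta>_def S_def)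
      moreover have "\<forall>\<^sub>F N in sequentially. dist (\<integral>\<omega>. f (Z N \<omega>) \<partial>M) (\<integral>\<omega>. f (random_hurwitz_zeta \<sigma> \<alpha> X \<omega>) \<partial>M) < e"
        by (rule tendstoD[OF lim_E e])
      ultimately have "\<forall>\<^sub>F N in sequentially. (\<forall>\<^sub>F T in at_top.
            integral {1..T} (\<lambda>t. (norm (\<zeta> t - S N t))\<^sup>2) \<le> e / (K1 + 1) * T) \<and>
          dist (\<integral>\<omega>. f (Z N \<omega>) \<partial>M) (\<integral>\<omega>. f (random_hurwitz_zeta \<sigma> \<alpha> X \<omega>) \<partial>M) < e"
        by (rule eventually_conj)
      then obtain N where N1: "\<forall>\<^sub>F T in at_top. integral {1..T} (\<lambda>t. (norm (\<zeta> t - S N t))\<^sup>2) \<le> e / (K1 + 1) * T"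
        and N2: "dist (\<integral>\<omega>. f (Z N \<omega>) \<partial>M) (\<integral>\<omega>. f (random_hurwitz_zeta \<sigma> \<alpha> X \<omega>) \<partial>M) < e"
        using eventually_happens by fastforce
      have "\<forall>\<^sub>F T in at_top. time_mean (\<lambda>t. (norm (S N t))\<^sup>2) T < C"
        by (rule order_tendstoD(2)[OF mean_S Z_sq]) (intro continuous_intros)
      moreover have "\<forall>\<^sub>F T in at_top. dist (time_mean (\<lambda>t. f (S N t)) T) (\<integral>\<omega>. f (Z N \<omega>) \<partial>M) < e"
        by (rule tendstoD[OF mean_S[OF f] e])
      moreover have "\<forall>\<^sub>F T in at_top. 2 * B / T < e"
        by (rule order_tendstoD(2)[OF _ e]) real_asymp
      ultimately show "\<forall>\<^sub>F T in at_top. dist (time_mean (\<lambda>t. f (\<zeta> t)) T) (\<integral>\<omega>. f (random_hurwitz_zeta \<sigma> \<alpha> X \<omega>) \<partial>M) < \<epsilon>"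
        using N1 eventually_ge_at_top[of 1]
      proof eventually_elim
        case (elim T)
        have T: "T \<ge> 1" by fact
        let ?q = "\<lambda>t. e + K1 * (norm (\<zeta> t - S N t))\<^sup>2 + K2 * (norm (S N t))\<^sup>2"
        have \<zeta>_cont: "continuous_on {1..T} \<zeta>"
          unfolding \<zeta>_def using \<alpha> by (intro continuous_on_hurwitz_zeta_vertical) auto
        have i: "(\<lambda>t. (norm (\<zeta> t - S N t))\<^sup>2) integrable_on {1..T}" "(\<lambda>t. (norm (S N t))\<^sup>2) integrable_on {1..T}"
          "(\<lambda>t. (norm (S N t))\<^sup>2) integrable_on {0..T}" "(\<lambda>t::real. e) integrable_on {1..T}"
          by (intro integrable_continuous_interval continuous_intros \<zeta>_cont S_cont)+
        have i': "(\<lambda>t. K1 * (norm (\<zeta> t - S N t))\<^sup>2) integrable_on {1..T}" "(\<lambda>t. K2 * (norm (S N t))\<^sup>2) integrable_on {1..T}"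
          by (intro integrable_on_mult_right i)+
        have "integral {1..T} ?q = integral {1..T} (\<lambda>t. e) + K1 * integral {1..T} (\<lambda>t. (norm (\<zeta> t - S N t))\<^sup>2) +
            K2 * integral {1..T} (\<lambda>t. (norm (S N t))\<^sup>2)"
          by (simp only: integral_add[OF integrable_add[OF i(4) i'(1)] i'(2)] integral_add[OF i(4) i'(1)] integral_mult_right)
        also have "integral {1..T} (\<lambda>t. e) \<le> e * T" using T e by simp
        also have "K1 * integral {1..T} (\<lambda>t. (norm (\<zeta> t - S N t))\<^sup>2) \<le> e * T"
        proof -
          have "K1 * integral {1..T} (\<lambda>t. (norm (\<zeta> t - S N t))\<^sup>2) \<le> K1 * (e / (K1 + 1) * T)"
            using elim K by (intro mult_left_mono) auto
          also have "\<dots> = (K1 / (K1 + 1)) * (e * T)" by simp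
          also have "\<dots> \<le> 1 * (e * T)" using K e T by (intro mult_right_mono) auto
          finally show ?thesis by simp
        qed
        also have "K2 * integral {1..T} (\<lambda>t. (norm (S N t))\<^sup>2) \<le> e * T"
        proof -
          have "integral {1..T} (\<lambda>t. (norm (S N t))\<^sup>2) \<le> integral {0..T} (\<lambda>t. (norm (S N t))\<^sup>2)"
            by (intro integral_subset_le i) auto
          also have "\<dots> \<le> C * T" using elim(1) T by (simp add: time_mean_def field_simps)
          finally have "K2 * integral {1..T} (\<lambda>t. (norm (S N t))\<^sup>2) \<le> K2 * (C * T)"
            using K by (intro mult_left_mono) auto
          also have "\<dots> = K2 * C * T" by simp
          also have "\<dots> \<le> e * T" using K T by (intro mult_right_mono) auto
          finally show ?thesis .
        qed
        finally have q_le: "integral {1..T} ?q \<le> 3 * e * T" by linarith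
        have "\<bar>time_mean (\<lambda>t. f (\<zeta> t)) T - time_mean (\<lambda>t. f (S N t)) T\<bar> \<le> (2 * B + integral {1..T} ?q) / T"
        proof (rule time_mean_diff_le_integral[OF T _ _ B B])
          show "(\<lambda>t. f (\<zeta> t)) integrable_on {0..T}"
            unfolding \<zeta>_def using T by (intro integral_zeta_value_measure(1)[OF \<alpha> _ fm B]) auto
          show "(\<lambda>t. f (S N t)) integrable_on {0..T}"
            by (intro integrable_continuous_interval continuous_on_compose2[OF f S_cont]) auto
          show "?q integrable_on {1..T}" by (intro integrable_add i i')
          show "\<bar>f (\<zeta> t) - f (S N t)\<bar> \<le> ?q t" for t by (rule mod)
        qed
        also have "\<dots> \<le> (2 * B + 3 * e * T) / T" using q_le T by (intro divide_right_mono) auto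
        also have "\<dots> = 2 * B / T + 3 * e" using T by (simp add: add_divide_distrib)
        finally have "\<bar>time_mean (\<lambda>t. f (\<zeta> t)) T - time_mean (\<lambda>t. f (S N t)) T\<bar> \<le> 2 * B / T + 3 * e" .
        thus ?case using elim(2,3) N2 e unfolding dist_real_def e_def by linarith
      qed
    qed
    moreover have "\<forall>\<^sub>F T in at_top. time_mean (\<lambda>t. f (\<zeta> t)) T = (\<integral>z. f z \<partial>zeta_value_measure \<sigma> \<alpha> T)"
      using eventually_gt_at_top[of 0]
      by eventually_elim (simp add: \<zeta>_def integral_zeta_value_measure(2)[OF \<alpha> _ fm B])
    ultimately have "((\<lambda>T. \<integral>z. f z \<partial>zeta_value_measure \<sigma> \<alpha> T) \<longlongrightarrow> (\<integral>\<omega>. f (random_hurwitz_zeta \<sigma> \<alpha> X \<omega>) \<partial>M)) at_top"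
      by (rule Lim_transform_eventually)
    thus "((\<lambda>T. \<integral>z. f z \<partial>zeta_value_measure \<sigma> \<alpha> T) \<longlongrightarrow>
        (\<integral>z. f z \<partial>distr M borel (random_hurwitz_zeta \<sigma> \<alpha> X))) at_top"
      by (subst integral_distr) auto
  qed
qed

end
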